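(* For every string $S$ of length $n$ whose maximum character frequency is $m$, there exists a data structure of ${\rm O}(nm)$ bits, in addition to $S$, such that for any query range $[l,r]$ with $0\le l\le r<n$ a mode of $S[l..r]$ can be reported in ${\rm O}(\min\{\log m,\log\log n\})$ time.
   Context: $S=S[0..n-1]$ is a string over an alphabet $\Sigma$. There is a bijection $\Sigma\to\{0,\dots,|\Sigma|-1\}$ computable in constant time. A mode of a non-empty multiset is an element whose multiplicity is at least that of every other element. A mode of $S[l..r]$ is a mode of the multiset $\{S[l],\dots,S[r]\}$. $m$ is the largest number of occurrences of any character in $S$. Space is counted in bits and excludes the input string $S$, which may be accessed during queries. *)

theory Defs
  imports Complex_Main "HOL-Library.Multiset"
begin

definition is_mode :: "'a multiset \<Rightarrow> 'a \<Rightarrow> bool" where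
  "is_mode M x \<longleftrightarrow> x \<in># M \<and> (\<forall>y\<in>#M. count M y \<le> count M x)"

definition range_mset :: "'a list \<Rightarrow> nat \<Rightarrow> nat \<Rightarrow> 'a multiset" where
  "range_mset S l r = mset (map (\<lambda>i. S ! i) [l..<Suc r])"

definition max_freq :: "'a list \<Rightarrow> nat" where
  "max_freq S = Max (range (count_list S))"

text \<open>
  Query algorithms are structured programs for a word RAM with word length \<open>w\<close>.  Each register
  holds an integer below \<open>2 ^ w\<close>, and one program mentions only finitely many registers.  The
  memory consists of two read-only parts: the bit string \<open>D\<close> (the data structure) and the input
  string \<open>T\<close>, given by its character codes.  A load returns the \<open>w\<close> consecutive bits of \<open>D\<close> from
  a bit address on, which on a machine with word-aligned access takes a constant number of
  instructions.  Thus the length of \<open>D\<close> is exactly the space of the data structure in bits.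
  The only working storage of a query is its registers.
\<close>

datatype binop =
  Add | Sub | Mul | Div | Mod | BitAnd | BitOr | BitXor | ShiftL | ShiftR | Less | Equal

type_synonym reg = nat

datatype prog =
    Skip
  | Const reg nat
  | Binop binop reg reg reg
  | LoadBits reg reg
  | ReadChar reg reg
  | Seq prog prog
  | IfNZ reg prog prog
  | WhileNZ reg prog

context
  includes bit_operations_syntax
begin

text \<open>Arithmetic is modulo \<open>2 ^ w\<close>; in particular subtraction wraps around.\<close>

fun binop_val :: "nat \<Rightarrow> binop \<Rightarrow> nat \<Rightarrow> nat \<Rightarrow> nat" where
  "binop_val w Add a b = (a + b) mod 2 ^ w"
| "binop_val w Sub a b = nat ((int a - int b) mod 2 ^ w)"
| "binop_val w Mul a b = (a * b) mod 2 ^ w"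
| "binop_val w Div a b = a div b"
| "binop_val w Mod a b = a mod b"
| "binop_val w BitAnd a b = a AND b"
| "binop_val w BitOr a b = a OR b"
| "binop_val w BitXor a b = a XOR b"
| "binop_val w ShiftL a b = push_bit b a mod 2 ^ w"
| "binop_val w ShiftR a b = drop_bit b a"
| "binop_val w Less a b = of_bool (a < b)"
| "binop_val w Equal a b = of_bool (a = b)"

end

text \<open>Least significant bit first; positions beyond the end of \<open>D\<close> read as zero.\<close>

definition load_bits :: "nat \<Rightarrow> bool list \<Rightarrow> nat \<Rightarrow> nat" where
  "load_bits w D i = horner_sum of_bool 2 (take w (drop i D))"

definition read_char :: "nat list \<Rightarrow> nat \<Rightarrow> nat" where
  "read_char T i = (if i < length T then T ! i else 0)"

text \<open>
  \<open>exec w D T P s t s'\<close>: from register contents \<open>s\<close>, program \<open>P\<close> terminates after \<open>t\<close> time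
  units with register contents \<open>s'\<close>.  Every instruction and every evaluation of a branch or
  loop condition (is the register nonzero?) takes one time unit.
\<close>

inductive exec ::
  "nat \<Rightarrow> bool list \<Rightarrow> nat list \<Rightarrow> prog \<Rightarrow> (reg \<Rightarrow> nat) \<Rightarrow> nat \<Rightarrow> (reg \<Rightarrow> nat) \<Rightarrow> bool"
  for w D T where
  Skip: "exec w D T Skip s 1 s"
| Const: "exec w D T (Const d k) s 1 (s(d := k mod 2 ^ w))"
| Binop: "exec w D T (Binop f d a b) s 1 (s(d := binop_val w f (s a) (s b)))"
| LoadBits: "exec w D T (LoadBits d a) s 1 (s(d := load_bits w D (s a)))"
| ReadChar: "exec w D T (ReadChar d a) s 1 (s(d := read_char T (s a)))"
| Seq: "exec w D T P s t s' \<Longrightarrow> exec w D T Q s' u s'' \<Longrightarrow> exec w D T (Seq P Q) s (t + u) s''"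
| IfTrue: "s a \<noteq> 0 \<Longrightarrow> exec w D T P s t s' \<Longrightarrow> exec w D T (IfNZ a P Q) s (1 + t) s'"
| IfFalse: "s a = 0 \<Longrightarrow> exec w D T Q s t s' \<Longrightarrow> exec w D T (IfNZ a P Q) s (1 + t) s'"
| WhileFalse: "s a = 0 \<Longrightarrow> exec w D T (WhileNZ a P) s 1 s"
| WhileTrue: "s a \<noteq> 0 \<Longrightarrow> exec w D T P s t s' \<Longrightarrow> exec w D T (WhileNZ a P) s' u s'' \<Longrightarrow>
    exec w D T (WhileNZ a P) s (1 + t + u) s''"

text \<open>
  Register contents when a query \<open>[l, r]\<close> on a string of length \<open>n\<close> starts.  The answer is
  expected in register 0.
\<close>

definition query_regs :: "nat \<Rightarrow> nat \<Rightarrow> nat \<Rightarrow> nat \<Rightarrow> reg \<Rightarrow> nat" where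
  "query_regs w n l r = (\<lambda>_. 0)(0 := l, 1 := r, 2 := n, 3 := w)"

text \<open>
  Program \<open>P\<close>, given \<open>D\<close> and access to \<open>S\<close>, reports a mode of \<open>S[l..r]\<close> within \<open>\<tau>\<close> time units,
  on a machine with word length \<open>w\<close>.  Characters are handled through their codes.
\<close>

definition reports_mode ::
  "nat \<Rightarrow> ('a \<Rightarrow> nat) \<Rightarrow> prog \<Rightarrow> bool list \<Rightarrow> 'a list \<Rightarrow> nat \<Rightarrow> nat \<Rightarrow> real \<Rightarrow> bool" where
  "reports_mode w code P D S l r \<tau> \<longleftrightarrow>
    (\<exists>t s x. exec w D (map code S) P (query_regs w (length S) l r) t s \<and> real t \<le> \<tau> \<and>
       is_mode (range_mset S l r) x \<and> s 0 = code x)"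

text \<open>
  The bound \<open>min {log m, log log n}\<close>, raised to 1 where it is smaller (for instance for
  \<open>m = 1\<close>), since every query takes at least constant time.  For \<open>n = 1\<close>, where \<open>log log n\<close>
  is undefined, the value is 1 as well.
\<close>

definition time_bound :: "nat \<Rightarrow> nat \<Rightarrow> real" where
  "time_bound n m = max 1 (min (log 2 (real m)) (log 2 (log 2 (real n))))"

end

theory Submission
  imports Defs
begin

text \<open>
  Let \<open>F l r\<close> be the frequency of a mode of \<open>S[l..r]\<close>; it decreases in \<open>l\<close>, increases in \<open>r\<close>, and
  changes by at most 1 per step.  For fixed \<open>k\<close>, the set \<open>{(l, r). k \<le> F l r}\<close> meets the
  antidiagonal \<open>l + r = t\<close> in an initial segment of some length \<open>G k t\<close>, and \<open>G k (t + 1) - G k t\<close> is 0 or 1.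
  So a bit vector of length \<open>2 n\<close> with constant-time rank decides \<open>k \<le> F l r\<close>; moreover, its bits
  around \<open>t = l + r\<close> show the position of a mode once \<open>k = F l r\<close> is known.  Over all \<open>k \<le> m\<close> this
  takes \<open>O(n m)\<close> bits, and binary search for \<open>k\<close> takes \<open>O(log m)\<close> time.

  If \<open>m\<close> is larger than \<open>log n\<close>, an approximation of \<open>F l r\<close> with polylogarithmic error is found first,
  so that the binary search takes \<open>O(log log n)\<close> time.  Partition the \<open>(l, r)\<close> plane into squares of side
  \<open>L\<close>.  Along an antidiagonal of squares, the ranges of \<open>F\<close> do not overlap, hence only \<open>O(m n / L)\<close>
  squares have nonconstant \<open>F\<close>.  Each of these gets a direct table of its subsquares of side about
  \<open>sqrt L * log n\<close>, which amounts to \<open>O(m n / (log n)\<^sup>2)\<close> table entries per level, and there are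
  \<open>O(log log n)\<close> levels until the side is polylogarithmic.
\<close>

section \<open>Mode frequencies\<close>

text \<open>The bound \<open>i < length S\<close> allows a right end beyond the string;
  antidiagonals and squares produce such intervals.\<close>

definition occ :: "'a list \<Rightarrow> nat \<Rightarrow> nat \<Rightarrow> 'a \<Rightarrow> nat" where
  "occ S l r x = card {i. l \<le> i \<and> i \<le> r \<and> i < length S \<and> S ! i = x}"

definition mfreq :: "'a list \<Rightarrow> nat \<Rightarrow> nat \<Rightarrow> nat" where
  "mfreq S l r = Max (insert 0 (occ S l r ` set S))"

lemma occ_le_mfreq: "occ S l r x \<le> mfreq S l r"
proof (cases "x \<in> set S")
  case True
  then show ?thesis unfolding mfreq_def by (intro Max_ge) auto
next
  case False
  then have "{i. l \<le> i \<and> i \<le> r \<and> i < length S \<and> S ! i = x} = {}"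
    using nth_mem by blast
  then have "occ S l r x = 0" unfolding occ_def by (simp only: card.empty)
  then show ?thesis by simp
qed

lemma mfreq_le_iff: "mfreq S l r \<le> k \<longleftrightarrow> (\<forall>x. occ S l r x \<le> k)"
proof
  assume "\<forall>x. occ S l r x \<le> k"
  then show "mfreq S l r \<le> k" unfolding mfreq_def by simp
qed (meson occ_le_mfreq le_trans)

lemma mfreq_attained:
  assumes "0 < k" "k \<le> mfreq S l r"
  shows "\<exists>x. k \<le> occ S l r x"
proof (rule ccontr)
  assume "\<not> ?thesis"
  then have "\<forall>x. occ S l r x \<le> k - 1" by (metis Suc_pred' assms(1) not_less_eq_eq)
  then have "mfreq S l r \<le> k - 1" by (simp add: mfreq_le_iff)
  with assms show False by simp
qed

lemma occ_mono:
  assumes "l' \<le> l" "r \<le> r'"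
  shows "occ S l r x \<le> occ S l' r' x"
  unfolding occ_def by (rule card_mono) (use assms in auto)

lemma mfreq_mono:
  assumes "l' \<le> l" "r \<le> r'"
  shows "mfreq S l r \<le> mfreq S l' r'"
  by (meson assms mfreq_le_iff occ_le_mfreq occ_mono le_trans)

lemma occ_add_right: "occ S l (r + u) x \<le> occ S l r x + u"
proof -
  have "occ S l (r + u) x
      \<le> card ({i. l \<le> i \<and> i \<le> r \<and> i < length S \<and> S ! i = x} \<union> {r <.. r + u})"
    unfolding occ_def by (rule card_mono) auto
  also have "\<dots> \<le> occ S l r x + card {r <.. r + u}"
    unfolding occ_def by (rule card_Un_le)
  finally show ?thesis by simp
qed

lemma occ_add_left: "occ S l r x \<le> occ S (l + u) r x + u"
proof -
  have "occ S l r x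
      \<le> card ({i. l + u \<le> i \<and> i \<le> r \<and> i < length S \<and> S ! i = x} \<union> {l ..< l + u})"
    unfolding occ_def by (rule card_mono) auto
  also have "\<dots> \<le> occ S (l + u) r x + card {l ..< l + u}"
    unfolding occ_def by (rule card_Un_le)
  finally show ?thesis by simp
qed

lemma mfreq_add: "mfreq S l (r + u) \<le> mfreq S (l + v) r + (u + v)"
  unfolding mfreq_le_iff
proof
  fix x
  have "occ S l (r + u) x \<le> occ S l r x + u" by (rule occ_add_right)
  also have "occ S l r x \<le> occ S (l + v) r x + v" by (rule occ_add_left)
  also have "occ S (l + v) r x \<le> mfreq S (l + v) r" by (rule occ_le_mfreq)
  finally show "occ S l (r + u) x \<le> mfreq S (l + v) r + (u + v)" by simp
qed

lemma mfreq_empty: "r < l \<Longrightarrow> mfreq S l r = 0"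
proof -
  assume "r < l"
  then have "{i. l \<le> i \<and> i \<le> r \<and> i < length S \<and> S ! i = x} = {}" for x by auto
  then have "occ S l r x = 0" for x by (simp add: occ_def)
  then show ?thesis using mfreq_le_iff[of S l r 0] by simp
qed

lemma mfreq_pos: "l \<le> r \<Longrightarrow> l < length S \<Longrightarrow> 0 < mfreq S l r"
proof -
  assume "l \<le> r" "l < length S"
  then have "card {l} \<le> occ S l r (S ! l)" unfolding occ_def by (intro card_mono) auto
  then show ?thesis using occ_le_mfreq[of S l r "S ! l"] by simp
qed

lemma count_list_conv_card: "count_list S x = card {i. i < length S \<and> S ! i = x}"
  by (simp add: count_list_eq_length_filter length_filter_conv_card eq_commute)

lemma finite_range_count_list: "finite (range (count_list S))"
proof (rule finite_subset)
  show "range (count_list S) \<subseteq> insert 0 (count_list S ` set S)"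
    by (auto simp: count_list_0_iff)
qed simp

lemma mfreq_le_max_freq: "mfreq S l r \<le> max_freq S"
  unfolding mfreq_le_iff
proof
  fix x
  have "occ S l r x \<le> count_list S x"
    unfolding occ_def count_list_conv_card by (rule card_mono) auto
  also have "\<dots> \<le> max_freq S"
    unfolding max_freq_def by (intro Max_ge finite_range_count_list) auto
  finally show "occ S l r x \<le> max_freq S" .
qed

lemma max_freq_le_length: "max_freq S \<le> length S"
  unfolding max_freq_def using finite_range_count_list
  by (subst Max_le_iff) (auto simp: count_le_length)

section \<open>Modes and their witnesses\<close>

lemma count_range_mset:
  assumes "r < length S"
  shows "count (range_mset S l r) x = occ S l r x"
proof -
  have "count (range_mset S l r) x = length (filter (\<lambda>i. S ! i = x) [l..<Suc r])"
    unfolding range_mset_def count_mset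
    by (simp add: count_list_eq_length_filter filter_map o_def eq_commute del: upt_Suc)
  also have "\<dots> = card (set (filter (\<lambda>i. S ! i = x) [l..<Suc r]))"
    by (rule distinct_card[symmetric]) (simp del: upt_Suc)
  also have "set (filter (\<lambda>i. S ! i = x) [l..<Suc r])
      = {i. l \<le> i \<and> i \<le> r \<and> i < length S \<and> S ! i = x}"
    using assms by auto
  finally show ?thesis by (simp add: occ_def)
qed

lemma is_modeI:
  assumes "l \<le> r" "r < length S" "mfreq S l r \<le> occ S l r x"
  shows "is_mode (range_mset S l r) x"
proof -
  have "0 < count (range_mset S l r) x"
    using mfreq_pos[of l r S] assms by (simp add: count_range_mset)
  then show ?thesis
    unfolding is_mode_def using assms(2,3) order_trans[OF occ_le_mfreq]
    by (metis count_greater_zero_iff count_range_mset)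
qed

text \<open>Removing position \<open>r\<close> lowers only the frequency of \<open>S ! r\<close>, so
  a character that reaches \<open>k\<close> before but not after the removal must be
  \<open>S ! r\<close>.\<close>

lemma last_is_mode_witness:
  assumes "0 < k" "k \<le> mfreq S l r" "mfreq S l (r - 1) < k" "0 < r"
  shows "k \<le> occ S l r (S ! r)"
proof -
  obtain x where x: "k \<le> occ S l r x" using mfreq_attained[OF assms(1,2)] by blast
  have "S ! r = x"
  proof (rule ccontr)
    assume "S ! r \<noteq> x"
    then have "occ S l r x \<le> occ S l (r - 1) x"
      unfolding occ_def by (intro card_mono) (auto simp: le_eq_less_or_eq)
    then show False using x assms(3) occ_le_mfreq[of S l "r - 1" x] by simp
  qed
  with x show ?thesis by simp
qed

lemma first_is_mode_witness:
  assumes "0 < k" "k \<le> mfreq S l r" "mfreq S (Suc l) r < k"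
  shows "k \<le> occ S l r (S ! l)"
proof -
  obtain x where x: "k \<le> occ S l r x" using mfreq_attained[OF assms(1,2)] by blast
  have "S ! l = x"
  proof (rule ccontr)
    assume "S ! l \<noteq> x"
    then have "occ S l r x \<le> occ S (Suc l) r x"
      unfolding occ_def by (intro card_mono) (auto simp: le_eq_less_or_eq Suc_le_eq)
    then show False using x assms(3) occ_le_mfreq[of S "Suc l" r x] by simp
  qed
  with x show ?thesis by simp
qed

section \<open>The threshold path of a frequency along antidiagonals\<close>

definition diag :: "'a list \<Rightarrow> nat \<Rightarrow> nat \<Rightarrow> nat" where
  "diag S k t = card {l. l \<le> t \<and> k \<le> mfreq S l (t - l)}"

text \<open>Finiteness yields a least non-member; closure under predecessors keeps everything above
  it out.\<close>

lemma down_closed_nat_eq: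
  fixes A :: "nat set"
  assumes "finite A" "\<And>x. Suc x \<in> A \<Longrightarrow> x \<in> A"
  shows "A = {..<card A}"
proof -
  have down: "x + y \<in> A \<Longrightarrow> x \<in> A" for x y by (induction y) (auto intro: assms(2))
  define u where "u = (LEAST u. u \<notin> A)"
  obtain u' where "u' \<notin> A" using assms(1) infinite_UNIV_nat by (metis UNIV_eq_I)
  then have u: "u \<notin> A" unfolding u_def by (rule LeastI)
  have "x \<in> A" if "x < u" for x using that not_less_Least u_def by blast
  moreover have "x < u" if "x \<in> A" for x
    using that u down[of u "x - u"] by (cases "x < u") auto
  ultimately have "A = {..<u}" by auto
  then show ?thesis by simp
qed

text \<open>Moving from \<open>Suc x\<close> to \<open>x\<close> on an antidiagonal widens the
  interval at both ends, so the set counted by \<open>diag\<close> is closed downwards. One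
  comparison with \<open>diag\<close> thus tests whether the mode frequency reaches
  \<open>k\<close>.\<close>

lemma less_diag_iff: "l < diag S k t \<longleftrightarrow> l \<le> t \<and> k \<le> mfreq S l (t - l)"
proof -
  let ?A = "{l. l \<le> t \<and> k \<le> mfreq S l (t - l)}"
  have "?A = {..<card ?A}"
  proof (rule down_closed_nat_eq)
    show "finite ?A" by (rule finite_subset[of _ "{..t}"]) auto
    fix x assume "Suc x \<in> ?A"
    moreover have "mfreq S (Suc x) (t - Suc x) \<le> mfreq S x (t - x)"
      by (rule mfreq_mono) auto
    ultimately show "x \<in> ?A" by auto
  qed
  then have "l \<in> ?A \<longleftrightarrow> l \<in> {..<card ?A}" by simp
  then show ?thesis by (simp add: diag_def)
qed

lemma diag_le: "diag S k t \<le> Suc t"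
  using less_diag_iff[of "Suc t" S k t] by linarith

text \<open>On the next antidiagonal, the same left end gets a larger right end, and a left end
  larger by one gets the same right end. One bit per antidiagonal therefore records
  \<open>diag S k\<close>.\<close>

lemma diag_Suc: "diag S k t \<le> diag S k (Suc t)" "diag S k (Suc t) \<le> Suc (diag S k t)"
proof -
  have "x < diag S k (Suc t)" if "x < diag S k t" for x
    using that mfreq_mono[of x x "t - x" "Suc t - x" S] unfolding less_diag_iff by force
  then show "diag S k t \<le> diag S k (Suc t)" by (meson not_less less_irrefl)
  have "x < diag S k t" if "Suc x < diag S k (Suc t)" for x
    using that mfreq_mono[of x "Suc x" "t - x" "t - x" S] unfolding less_diag_iff by auto
  then show "diag S k (Suc t) \<le> Suc (diag S k t)" by (meson not_less less_irrefl)
qed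

text \<open>
  On the antidiagonal through \<open>(l, r)\<close>, the innermost interval that still has a character of
  frequency \<open>k\<close> ends at such a character; the next bit of the path says on which side.
\<close>

lemma diag_witness:
  assumes lr: "l \<le> r" "r < length S"
    and k: "k = mfreq S l r" and g: "g = diag S k (l + r)" and g': "g' = diag S k (l + r + 1)"
    and pos: "pos = (if g' = g then g - 1 else l + r - (g - 1))"
  shows "pos < length S" "is_mode (range_mset S l r) (S ! pos)"
proof -
  \<comment> \<open>\<open>?L\<close> is the last left end on the antidiagonal of
    \<open>(l, r)\<close> that reaches \<open>k\<close>. The interval from \<open>?L\<close> to
    \<open>?R\<close> lies inside \<open>[l, r]\<close>, so a character occurring \<open>k\<close>
    times in it is a mode of \<open>[l, r]\<close>.\<close>
  let ?t = "l + r" and ?L = "g - 1"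
  let ?R = "l + r - ?L"
  have k0: "0 < k" unfolding k using lr by (intro mfreq_pos) auto
  have lg: "l < g" unfolding g less_diag_iff using k by simp
  then have L: "?L < g" "l \<le> ?L" by auto
  have FLR: "k \<le> mfreq S ?L ?R" "?L \<le> ?t" using L(1) unfolding g less_diag_iff by auto
  have LR: "?L \<le> ?R" using FLR(1) k0 mfreq_empty[of ?R ?L S] by linarith
  have R: "?R \<le> r" using L by auto
  have Suc_L: "Suc ?L = g" using L by simp
  have occs: "is_mode (range_mset S l r) x" if "k \<le> occ S l' r' x" "l \<le> l'" "r' \<le> r" for l' r' x
    using that occ_mono[of l l' r' r S x] k by (intro is_modeI lr) auto
  \<comment> \<open>On the next antidiagonal the left end \<open>g\<close> has right end
    \<open>?R\<close>. If it fails to reach \<open>k\<close>, removing \<open>?L\<close> has lost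
    the frequency, and \<open>S ! ?L\<close> is a witness. Otherwise removing \<open>?R\<close> from
    that interval loses it, since \<open>g\<close> fails on the present antidiagonal.\<close>
  show "is_mode (range_mset S l r) (S ! pos)"
  proof (cases "g' = g")
    case True
    have "\<not> g < g'" using True by simp
    then have "\<not> k \<le> mfreq S g (?t + 1 - g)"
      using FLR(2) Suc_L unfolding g' less_diag_iff by auto
    moreover have "?t + 1 - g = ?R" using Suc_L FLR(2) by linarith
    ultimately have "mfreq S (Suc ?L) ?R < k" using Suc_L by simp
    from first_is_mode_witness[OF k0 FLR(1) this] show ?thesis
      using True L R pos by (intro occs) auto
  next
    case False
    then have "g < g'" using diag_Suc(1)[of S k ?t] g g' by simp
    then have 1: "k \<le> mfreq S g (?t + 1 - g)" unfolding g' less_diag_iff by simp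
    moreover have eq: "?t + 1 - g = ?R" using Suc_L FLR(2) by linarith
    ultimately have gR: "g \<le> ?R" using k0 mfreq_empty[of ?R g S] by (metis linorder_not_le le_zero_eq)
    have "\<not> g < diag S k ?t" using g by simp
    then have "\<not> k \<le> mfreq S g (?t - g)" using gR unfolding less_diag_iff by linarith
    moreover have "?t - g = ?R - 1" using eq by linarith
    ultimately have "mfreq S g (?R - 1) < k" by simp
    from last_is_mode_witness[OF k0 _ this] 1 eq gR Suc_L
    have "k \<le> occ S g ?R (S ! ?R)" by simp
    then show ?thesis using False L R pos by (intro occs[of g ?R]) auto
  qed
  show "pos < length S" using pos R LR lr by auto
qed

section \<open>Straight-line programs and loops\<close>

text \<open>A functional semantics of instructions lets rewriting evaluate straight-line code. The
  last clause covers \<open>Skip\<close>; for control structures it is a dummy, excluded by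
  \<open>is_instr\<close>.\<close>

fun act :: "nat \<Rightarrow> bool list \<Rightarrow> nat list \<Rightarrow> prog \<Rightarrow> (reg \<Rightarrow> nat) \<Rightarrow> reg \<Rightarrow> nat" where
  "act w D T (Const d k) s = s(d := k mod 2 ^ w)"
| "act w D T (Binop f d a b) s = s(d := binop_val w f (s a) (s b))"
| "act w D T (LoadBits d a) s = s(d := load_bits w D (s a))"
| "act w D T (ReadChar d a) s = s(d := read_char T (s a))"
| "act w D T _ s = s"

fun is_instr :: "prog \<Rightarrow> bool" where
  "is_instr (Seq P Q) = False"
| "is_instr (IfNZ a P Q) = False"
| "is_instr (WhileNZ a P) = False"
| "is_instr P = True"

definition block :: "prog list \<Rightarrow> prog" where
  "block ps = foldr Seq ps Skip"

lemma exec_act: "is_instr i \<Longrightarrow> exec w D T i s 1 (act w D T i s)"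
  by (cases i) (auto intro: exec.intros simp del: One_nat_def)

text \<open>The extra time unit is the \<open>Skip\<close> that ends a \<open>block\<close>.\<close>

lemma exec_block:
  "list_all is_instr ps \<Longrightarrow> exec w D T (block ps) s (length ps + 1) (fold (act w D T) ps s)"
proof (induction ps arbitrary: s)
  case Nil
  then show ?case using exec.Skip by (simp add: block_def)
next
  case (Cons i ps)
  have "exec w D T (Seq i (block ps)) s (1 + (length ps + 1)) (fold (act w D T) ps (act w D T i s))"
    by (rule exec.Seq[OF exec_act Cons.IH]) (use Cons.prems in auto)
  then show ?case by (simp add: block_def)
qed

text \<open>The index of the invariant bounds the remaining rounds. Each round costs
  \<open>c\<close> plus one test, and the last test adds 1; \<open>j\<close> is left open because
  the loop may stop early.\<close>

lemma exec_while:
  assumes body: "\<And>i s. I i s \<Longrightarrow> s a \<noteq> 0 \<Longrightarrow> 0 < i \<and> (\<exists>s'. exec w D T P s c s' \<and> I (i - 1) s')"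
  assumes init: "I i s"
  shows "\<exists>t s' j. exec w D T (WhileNZ a P) s t s' \<and> t \<le> i * (c + 1) + 1 \<and> I j s' \<and> s' a = 0"
  using init
proof (induction i arbitrary: s)
  case 0
  then have "s a = 0" using body by blast
  then show ?case using 0 exec.WhileFalse[of s a w D T P]
    by (metis add_0 le_refl mult_0)
next
  case (Suc i)
  show ?case
  proof (cases "s a = 0")
    case True
    then show ?thesis using Suc.prems exec.WhileFalse[of s a w D T P]
      by (metis le_add2)
  next
    case False
    then obtain s' where s': "exec w D T P s c s'" "I i s'"
      using body[OF Suc.prems] by auto
    from Suc.IH[OF s'(2)] obtain t s'' j where t: "exec w D T (WhileNZ a P) s' t s''"
      "t \<le> i * (c + 1) + 1" "I j s''" "s'' a = 0" by blast
    have "exec w D T (WhileNZ a P) s (1 + c + t) s''"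
      by (rule exec.WhileTrue[OF False s'(1) t(1)])
    moreover have "1 + c + t \<le> Suc i * (c + 1) + 1" using t(2) by simp
    ultimately show ?thesis using t(3,4) by blast
  qed
qed

section \<open>Memory as an array of cells\<close>

text \<open>The whole memory is one number with the cells as digits, which turns loads into division
  and remainder.\<close>

definition cells_val :: "nat \<Rightarrow> nat list \<Rightarrow> nat" where
  "cells_val \<phi> fs = horner_sum id (2 ^ \<phi>) fs"

definition encode :: "nat \<Rightarrow> nat list \<Rightarrow> bool list" where
  "encode \<phi> fs = map (bit (cells_val \<phi> fs)) [0..<\<phi> * length fs]"

lemma cells_val_less:
  assumes "\<And>x. x \<in> set fs \<Longrightarrow> x < 2 ^ \<phi>"
  shows "cells_val \<phi> fs < 2 ^ (\<phi> * length fs)"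
  using assms
proof (induction fs)
  case (Cons x fs)
  have "cells_val \<phi> fs + 1 \<le> 2 ^ (\<phi> * length fs)" using Cons by (simp add: Suc_leI)
  then have "2 ^ \<phi> * (cells_val \<phi> fs + 1) \<le> 2 ^ \<phi> * 2 ^ (\<phi> * length fs)"
    using mult_le_mono2 by blast
  moreover have "x < 2 ^ \<phi>" using Cons by simp
  ultimately show ?case by (simp add: cells_val_def power_add)
qed (simp add: cells_val_def)

lemma cells_val_nth:
  assumes "\<And>x. x \<in> set fs \<Longrightarrow> x < 2 ^ \<phi>" "i < length fs"
  shows "cells_val \<phi> fs div 2 ^ (i * \<phi>) mod 2 ^ \<phi> = fs ! i"
  using assms
proof (induction fs arbitrary: i)
  case (Cons x fs)
  have x: "x < 2 ^ \<phi>" using Cons by simp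
  have eq: "cells_val \<phi> (x # fs) = x + 2 ^ \<phi> * cells_val \<phi> fs" by (simp add: cells_val_def)
  show ?case
  proof (cases i)
    case 0
    then show ?thesis using x eq by simp
  next
    case (Suc j)
    have "cells_val \<phi> (x # fs) div 2 ^ (i * \<phi>) = cells_val \<phi> (x # fs) div 2 ^ \<phi> div 2 ^ (j * \<phi>)"
      by (simp add: Suc power_add div_mult2_eq)
    also have "cells_val \<phi> (x # fs) div 2 ^ \<phi> = cells_val \<phi> fs" using x eq by simp
    finally show ?thesis using Cons Suc by simp
  qed
qed simp

text \<open>The zeros read past the end are also the high bits of the number, by
  \<open>cells_val_less\<close>, so every address obeys one formula.\<close>

lemma load_bits_encode:
  assumes "\<And>x. x \<in> set fs \<Longrightarrow> x < 2 ^ \<phi>"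
  shows "load_bits w (encode \<phi> fs) i = cells_val \<phi> fs div 2 ^ i mod 2 ^ w"
proof -
  let ?V = "cells_val \<phi> fs" and ?n = "\<phi> * length fs"
  have "take w (drop i (encode \<phi> fs)) = map (bit ?V) (take w (drop i [0..<?n]))"
    by (simp add: encode_def take_map drop_map)
  also have "take w (drop i [0..<?n]) = [i..<min (i + w) ?n]"
    by (cases "i + w \<le> ?n") (auto simp: take_upt drop_upt min_def)
  also have "[i..<min (i + w) ?n] = map (\<lambda>j. j + i) [0..<min w (?n - i)]"
    by (cases "i \<le> ?n") (auto simp: map_add_upt min_def add.commute)
  finally have "load_bits w (encode \<phi> fs) i
      = horner_sum of_bool 2 (map (bit (drop_bit i ?V)) [0..<min w (?n - i)])"
    by (simp add: load_bits_def o_def bit_drop_bit_eq add.commute)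
  also have "\<dots> = take_bit (min w (?n - i)) (drop_bit i ?V)"
    by (rule horner_sum_bit_eq_take_bit)
  also have "\<dots> = take_bit w (take_bit (?n - i) (drop_bit i ?V))" by (simp add: ac_simps)
  also have "take_bit (?n - i) (drop_bit i ?V) = drop_bit i (take_bit ?n ?V)"
    by (simp add: drop_bit_take_bit)
  also have "take_bit ?n ?V = ?V"
    using cells_val_less[OF assms] by (simp add: take_bit_nat_eq_self)
  finally show ?thesis by (simp add: take_bit_eq_mod drop_bit_eq_div)
qed

text \<open>Subtracting 1 flips exactly the bits up to the lowest set bit. The header uses this to
  find the cell width in constant time.\<close>

lemma xor_pred:
  includes bit_operations_syntax
  fixes z :: nat
  shows "(2 ^ k + 2 ^ Suc k * z) XOR (2 ^ k + 2 ^ Suc k * z - 1) = 2 ^ Suc k - 1"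
proof (rule bit_eqI)
  fix i
  have "push_bit (Suc k) z + push_bit k 1 = push_bit (Suc k) z OR push_bit k 1"
    by (rule disjunctive_add) (unfold bit_push_bit_iff bit_1_iff, auto)
  then have e1: "2 ^ k + 2 ^ Suc k * z = push_bit (Suc k) z OR push_bit k 1"
    by (simp add: push_bit_eq_mult ac_simps)
  have "push_bit (Suc k) z + mask k = push_bit (Suc k) z OR mask k"
    by (rule disjunctive_add) (auto simp: bit_push_bit_iff bit_mask_iff)
  then have e2: "2 ^ k + 2 ^ Suc k * z - 1 = push_bit (Suc k) z OR mask k"
    by (simp add: push_bit_eq_mult mask_eq_exp_minus_1 ac_simps)
  have e3: "(2 ^ Suc k - 1 :: nat) = mask (Suc k)" by (simp add: mask_eq_exp_minus_1)
  show "bit ((2 ^ k + 2 ^ Suc k * z) XOR (2 ^ k + 2 ^ Suc k * z - 1)) i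
      = bit (2 ^ Suc k - 1 :: nat) i"
    unfolding e2 unfolding e1 e3 bit_xor_iff bit_or_iff bit_push_bit_iff bit_mask_iff bit_1_iff
    by auto
qed

section \<open>The query program\<close>

definition get :: "reg \<Rightarrow> reg \<Rightarrow> prog list" where
  "get x y = [Binop Mul x y 5, LoadBits x x, Binop Mod x x 4]"

text \<open>
  Registers during a query: 0 and 1 hold \<open>l\<close> and \<open>r\<close>, 4 and 5 hold \<open>2 ^ \<phi>\<close> and the cell width \<open>\<phi>\<close>,
  6 holds 1, 7 to 11 hold the block length \<open>b\<close>, the row length \<open>q\<close>, the addresses of the rank
  directory and of the popcount table, and \<open>Suc m\<close>; 12 is the step of the final binary search, 13 the
  address of the current tree node (0 at a leaf), 14 and 15 give its side length \<open>2 ^ (a + d)\<close>,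
  16 is the current lower bound on the mode frequency, and 17 holds \<open>l + r\<close>.
  Cells 2 to 11 of the memory contain the initial values of registers 7 to 16.
\<close>

definition rank_code :: "reg \<Rightarrow> reg \<Rightarrow> reg \<Rightarrow> prog list" where
  "rank_code d k t =
    [Binop Div 20 t 7, Binop Mod 21 t 7, Binop Mul 22 k 8, Binop Add 22 22 20,
     Binop Add 22 22 20, Binop Add 22 22 9] @ get 23 22 @ [Binop Add 22 22 6] @ get 22 22 @
    [Binop Mul 22 22 7, Binop Add 22 22 21, Binop Add 22 22 10] @ get 22 22 @
    [Binop Add d 23 22]"

text \<open>
  The machine does not know \<open>\<phi>\<close>, and cannot compute it from \<open>n\<close> in constant time.  Cell 0 contains
  \<open>2 ^ (\<phi> - 1)\<close>, so that the lowest set bit of the first word reveals \<open>2 ^ \<phi>\<close>; cell 1 contains \<open>\<phi>\<close>.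
\<close>

definition header_code :: "prog list" where
  "header_code =
    [Const 6 1, LoadBits 20 4, Binop Sub 21 20 6, Binop BitXor 21 20 21, Binop Add 4 21 6,
     Binop Div 20 20 4, Binop Mod 5 20 4] @
    concat (map (\<lambda>(x, i). Const x i # get x x)
      [(7, 2), (8, 3), (9, 4), (10, 5), (11, 6), (12, 7), (13, 8), (14, 9), (15, 10), (16, 11)]) @
    [Binop Add 17 0 1]"

text \<open>A table entry has two cells, a lower bound and a child address. Its index consists of
  the bits of \<open>l\<close> and \<open>r\<close> by which the child refines the node, as in
  \<open>entry\<close>.\<close>

definition descend_code :: "prog list" where
  "descend_code =
    [Binop ShiftR 20 14 6, Binop Add 21 20 15, Binop Sub 22 14 20, Binop ShiftL 22 6 22,
     Binop ShiftR 23 0 21, Binop Mod 23 23 22, Binop Mul 23 23 22,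
     Binop ShiftR 24 1 21, Binop Mod 24 24 22, Binop Add 23 23 24, Binop Add 23 23 23,
     Binop Add 23 23 13] @ get 16 23 @ [Binop Add 23 23 6] @ get 13 23 @ [Binop ShiftR 14 14 6]"

text \<open>Multiplying the step by the comparison bit replaces a branch, so a round of the search
  is straight-line code.\<close>

definition search_code :: "prog list" where
  "search_code =
    Binop Add 24 16 12 # rank_code 25 24 17 @
    [Binop Less 25 0 25, Binop Less 26 24 11, Binop BitAnd 25 25 26, Binop Mul 25 25 12,
     Binop Add 16 16 25, Binop ShiftR 12 12 6]"

text \<open>Register 27 gets the path bit and registers 25 and 26 the two candidate positions of
  \<open>diag_witness\<close>; \<open>mode_query\<close> selects one.\<close>

definition witness_code :: "prog list" where
  "witness_code =
    rank_code 25 16 17 @ [Binop Add 26 17 6] @ rank_code 27 16 26 @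
    [Binop Sub 27 27 25, Binop Sub 25 25 6, Binop Sub 26 17 25]"

lemma code_instrs:
  "list_all is_instr header_code" "list_all is_instr descend_code"
  "list_all is_instr search_code" "list_all is_instr witness_code"
  by (simp_all add: header_code_def descend_code_def search_code_def witness_code_def rank_code_def
    get_def)

lemma code_lengths:
  "length header_code = 48" "length descend_code = 20" "length search_code = 27"
  "length witness_code = 44"
  by (simp_all add: header_code_def descend_code_def search_code_def witness_code_def rank_code_def
    get_def)

definition mode_query :: prog where
  "mode_query =
    Seq (block header_code)
    (Seq (WhileNZ 13 (block descend_code))
    (Seq (WhileNZ 12 (block search_code))
    (Seq (block witness_code) (IfNZ 27 (ReadChar 0 26) (ReadChar 0 25)))))"

definition entry :: "nat \<Rightarrow> nat \<Rightarrow> nat \<Rightarrow> nat \<Rightarrow> nat" where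
  "entry a d l r = (let e = a + d div 2; h = d - d div 2 in
     (l div 2 ^ e) mod 2 ^ h * 2 ^ h + (r div 2 ^ e) mod 2 ^ h)"

text \<open>
  Within \<open>i\<close> steps, the pointers from node \<open>p\<close> lead to a leaf whose value \<open>v\<close> is a lower bound for \<open>f\<close>
  with error below \<open>2 * step\<close>.
\<close>

fun search_path :: "nat list \<Rightarrow> nat \<Rightarrow> nat \<Rightarrow> nat \<Rightarrow> nat \<Rightarrow> nat \<Rightarrow> nat \<Rightarrow> nat \<Rightarrow> nat \<Rightarrow> nat \<Rightarrow> bool" where
  "search_path fs a step l r f 0 p v d \<longleftrightarrow> p = 0 \<and> v \<le> f \<and> f < v + 2 * step"
| "search_path fs a step l r f (Suc i) p v d \<longleftrightarrow>
    p = 0 \<and> v \<le> f \<and> f < v + 2 * step \<or>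
    (let j = p + 2 * entry a d l r in
     p \<noteq> 0 \<and> d < 2 ^ Suc i \<and> Suc j < length fs \<and>
     search_path fs a step l r f i (fs ! Suc j) (fs ! j) (d div 2))"

text \<open>This isolates what the program needs for one query; \<open>f\<close> and
  \<open>G\<close> stand for the mode frequency and \<open>diag S\<close>. By \<open>word\<close>,
  products of two cells do not overflow.\<close>

locale query_machine =
  fixes w \<phi> :: nat and fs T :: "nat list" and l r n f m :: nat and G :: "nat \<Rightarrow> nat \<Rightarrow> nat"
    and b q base1 base2 iter1 iter2 :: nat
  assumes word: "4 * \<phi> \<le> w" and phi: "0 < \<phi>"
    and cells: "\<And>x. x \<in> set fs \<Longrightarrow> x < 2 ^ \<phi>" and len: "length fs < 2 ^ \<phi>" "11 < length fs"
    and fs01: "fs ! 0 = 2 ^ (\<phi> - 1)" "fs ! 1 = \<phi>"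
    and hdr: "fs ! 2 = b" "fs ! 3 = q" "fs ! 4 = base1" "fs ! 5 = base2" "fs ! 6 = Suc m"
    and q: "0 < b"
    and lr: "l \<le> r" "r < n" "2 * n < 2 ^ \<phi>"
    and rank: "\<And>k t. k \<le> m \<Longrightarrow> t < 2 * n \<Longrightarrow>
      (let i = k * q + 2 * (t div b) + base1; j = fs ! Suc i * b + t mod b + base2 in
       Suc i < length fs \<and> j < length fs \<and> fs ! i + fs ! j = G k t \<and> G k t < 2 ^ \<phi>)"
    and Gf: "\<And>k. 0 < k \<Longrightarrow> l < G k (l + r) \<longleftrightarrow> k \<le> f"
    and fm: "f \<le> m" and f0: "0 < f"
    and Gdiag: "\<And>k t. G k t \<le> G k (Suc t)" "\<And>k t. G k t \<le> Suc t"
    and step: "fs ! 7 = 2 ^ (iter2 - 1)" "0 < iter2"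
    and path: "search_path fs (fs ! 10) (fs ! 7) l r f iter1 (fs ! 8) (fs ! 11) (fs ! 9)"
    and small_d: "fs ! 9 \<le> \<phi>" "fs ! 10 \<le> \<phi>"
begin

abbreviation "D \<equiv> encode \<phi> fs"
abbreviation "run \<equiv> fold (act w D T)"

text \<open>A total version of cell access: the search also probes frequencies above
  \<open>m\<close>, where addresses may be invalid.\<close>

definition cell :: "nat \<Rightarrow> nat" where
  "cell i = load_bits w D (i * \<phi> mod 2 ^ w) mod 2 ^ \<phi>"

lemma phi_less: "\<phi> < 2 ^ \<phi>" by simp

lemma pow_le: "k \<le> 4 * \<phi> \<Longrightarrow> 2 ^ k \<le> (2 ^ w :: nat)"
  using word by (meson le_trans one_le_numeral power_increasing)

lemma lt_w: "x < 2 ^ \<phi> \<Longrightarrow> x < 2 ^ w" for x :: nat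
  by (rule less_le_trans[OF _ pow_le]) auto

lemma mult_lt_w: "x < 2 ^ \<phi> \<Longrightarrow> y < 2 ^ \<phi> \<Longrightarrow> x * y < 2 ^ w" for x y :: nat
proof -
  assume "x < 2 ^ \<phi>" "y < 2 ^ \<phi>"
  then have "x * y < 2 ^ \<phi> * 2 ^ \<phi>" by (intro mult_strict_mono') auto
  also have "\<dots> = (2 ^ (2 * \<phi>) :: nat)" by (simp add: power_add mult_2)
  also have "\<dots> \<le> 2 ^ w" by (rule pow_le) simp
  finally show ?thesis .
qed

lemma double_lt_w: "2 * 2 ^ \<phi> < (2 ^ w :: nat)"
proof -
  have "2 * 2 ^ \<phi> = (2 ^ Suc \<phi> :: nat)" by simp
  also have "\<dots> < 2 ^ w" using word phi by (intro power_strict_increasing) auto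
  finally show ?thesis .
qed

lemma add_lt_w: "x < 2 ^ \<phi> \<Longrightarrow> y < 2 ^ \<phi> \<Longrightarrow> x + y < 2 ^ w" for x y :: nat
  using double_lt_w by linarith

lemma cell_nth: "i < length fs \<Longrightarrow> cell i = fs ! i"
proof -
  assume i: "i < length fs"
  then have "i * \<phi> < 2 ^ w" using len phi_less by (intro mult_lt_w) auto
  moreover have "(2 :: nat) ^ \<phi> dvd 2 ^ w" using word by (simp add: le_imp_power_dvd)
  ultimately show ?thesis using cells_val_nth[OF cells i]
    by (simp add: cell_def load_bits_encode[OF cells] mod_mod_cancel)
qed

lemma nth_less: "i < length fs \<Longrightarrow> fs ! i < 2 ^ \<phi>"
  using cells by simp

lemma run_get:
  assumes "s 4 = 2 ^ \<phi>" "s 5 = \<phi>" "x \<noteq> 4"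
  shows "run (get x y) s = s(x := cell (s y))"
  using assms by (simp add: get_def cell_def)

definition frame :: "(reg \<Rightarrow> nat) \<Rightarrow> bool" where
  "frame s \<longleftrightarrow> s 0 = l \<and> s 1 = r \<and> s 4 = 2 ^ \<phi> \<and> s 5 = \<phi> \<and> s 6 = 1 \<and> s 7 = b \<and> s 8 = q \<and>
     s 9 = base1 \<and> s 10 = base2 \<and> s 11 = Suc m \<and> s 17 = l + r"

lemma run_rank:
  assumes s: "frame s" and x: "x \<in> {24..30}" "y \<in> {16,24}" "z \<in> {17,26}"
  shows "\<exists>u0 u1 u2 u3 v. run (rank_code x y z) s = s(20 := u0, 21 := u1, 22 := u2, 23 := u3, x := v) \<and>
     (s y \<le> m \<longrightarrow> s z < 2 * n \<longrightarrow> v = G (s y) (s z))"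
proof -
  let ?k = "s y" and ?t = "s z"
  define i where "i = (?k * q + 2 * (?t div b) + base1) mod 2 ^ w"
  define j where "j = (cell (Suc i mod 2 ^ w) * b + ?t mod b + base2) mod 2 ^ w"
  define v where "v = (cell i + cell j) mod 2 ^ w"
  have [simp]: "x \<noteq> 20" "x \<noteq> 21" "x \<noteq> 22" "x \<noteq> 23" using x by auto
  have [simp]: "y \<noteq> 20" "y \<noteq> 21" "y \<noteq> 22" "y \<noteq> 23" using x by auto
  have [simp]: "z \<noteq> 20" using x by auto
  have "run (rank_code x y z) s
    = s(20 := ?t div b, 21 := ?t mod b, 22 := cell j, 23 := cell i, x := v)"
    using s by (simp add: rank_code_def run_get frame_def mod_simps i_def j_def v_def mult_2
      ac_simps fun_upd_twist)
  moreover have "v = G ?k ?t" if kt: "?k \<le> m" "?t < 2 * n"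
  proof -
    define i' where "i' = ?k * q + 2 * (?t div b) + base1"
    define j' where "j' = fs ! Suc i' * b + ?t mod b + base2"
    have R: "Suc i' < length fs" "j' < length fs" "fs ! i' + fs ! j' = G ?k ?t" "G ?k ?t < 2 ^ \<phi>"
      using rank[OF kt] by (auto simp: Let_def i'_def j'_def)
    have "i' < 2 ^ w" "Suc i' < 2 ^ w" "j' < 2 ^ w" using R len lt_w by auto
    then have "i = i'" "j = j'" using R by (simp_all add: i_def j_def i'_def j'_def cell_nth)
    then show ?thesis using R lt_w by (simp add: v_def cell_nth)
  qed
  ultimately show ?thesis by blast
qed


lemma binop_Sub: "y \<le> x \<Longrightarrow> x < 2 ^ w \<Longrightarrow> binop_val w Sub x y = x - y"
proof -
  assume "y \<le> x" "x < 2 ^ w"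
  then have "(int x - int y) mod 2 ^ w = int ((x - y) mod 2 ^ w)"
    by (simp only: of_nat_diff[symmetric] zmod_int of_nat_power of_nat_numeral)
  also have "(x - y) mod 2 ^ w = x - y" using \<open>x < 2 ^ w\<close> by simp
  finally show ?thesis by simp
qed

text \<open>A word spans at least two cells, so one load yields both \<open>fs ! 0\<close> and
  \<open>fs ! 1\<close>.\<close>

lemma header_word:
  defines "X \<equiv> load_bits w D 0"
  shows "X mod 2 ^ \<phi> = 2 ^ (\<phi> - 1)" "X div 2 ^ \<phi> mod 2 ^ \<phi> = \<phi>" "X < 2 ^ w"
proof -
  let ?V = "cells_val \<phi> fs"
  have X: "X = ?V mod 2 ^ w" by (simp add: X_def load_bits_encode[OF cells])
  then show "X < 2 ^ w" by simp
  have "(2 :: nat) ^ \<phi> dvd 2 ^ w" using word by (simp add: le_imp_power_dvd)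
  moreover have ne: "0 < length fs" "fs \<noteq> []" using len by auto
  ultimately show "X mod 2 ^ \<phi> = 2 ^ (\<phi> - 1)"
    using cells_val_nth[of fs \<phi> 0, OF cells] ne fs01 by (simp add: X mod_mod_cancel)
  have "X div 2 ^ \<phi> mod 2 ^ \<phi> = take_bit \<phi> (drop_bit \<phi> (take_bit w ?V))"
    by (simp add: X take_bit_eq_mod drop_bit_eq_div)
  also have "\<dots> = take_bit \<phi> (drop_bit \<phi> ?V)"
    using word phi min_absorb1[of \<phi> "w - \<phi>"] by (simp add: drop_bit_take_bit)
  also have "\<dots> = \<phi>"
    using cells_val_nth[of fs \<phi> 1, OF cells] len fs01 by (simp add: take_bit_eq_mod drop_bit_eq_div)
  finally show "X div 2 ^ \<phi> mod 2 ^ \<phi> = \<phi>" .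
qed

lemma run_header:
  fixes s0 :: "reg \<Rightarrow> nat"
  defines "s \<equiv> run header_code s0"
  assumes s0: "s0 0 = l" "s0 1 = r" "s0 4 = 0"
  shows "frame s" "s 12 = fs ! 7" "s 13 = fs ! 8" "s 14 = fs ! 9" "s 15 = fs ! 10" "s 16 = fs ! 11"
proof -
  include bit_operations_syntax
  define X where "X = load_bits w D 0"
  note X = header_word[folded X_def]
  \<comment> \<open>Cell 0 makes \<open>\<phi> - 1\<close> the position of the lowest set bit in the
    first word, whose address is the initial 0 of register 4.\<close>
  have "X = 2 ^ (\<phi> - 1) + 2 ^ Suc (\<phi> - 1) * (X div 2 ^ \<phi>)"
    using X(1) phi by (metis Suc_diff_1 add.commute mult_div_mod_eq)
  then have xor: "X XOR (X - 1) = 2 ^ \<phi> - 1" using xor_pred phi by (metis Suc_diff_1)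
  have X1: "1 \<le> X" using X(1) by (metis One_nat_def Suc_leI gr0I mod_0 power_not_zero zero_neq_numeral)
  have one: "1 mod 2 ^ w = (1 :: nat)" using word phi by simp
  have M: "(2 ^ \<phi> - 1 + 1) mod 2 ^ w = (2 ^ \<phi> :: nat)" proof -
    have "(2 :: nat) ^ \<phi> < 2 ^ w" using double_lt_w by linarith
    then show ?thesis by simp
  qed
  have c: "i mod 2 ^ w = i" if "i \<le> 11" for i :: nat using that len lt_w by auto
  have part1: "run [Const 6 1, LoadBits 20 4, Binop Sub 21 20 6, Binop BitXor 21 20 21, Binop Add 4 21 6,
     Binop Div 20 20 4, Binop Mod 5 20 4] s0
    = s0(6 := 1, 20 := X div 2 ^ \<phi>, 21 := 2 ^ \<phi> - 1, 4 := 2 ^ \<phi>, 5 := \<phi>)"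
    using X X1 xor M one s0(3)
    by (simp add: binop_Sub fun_upd_twist del: binop_val.simps(2) One_nat_def flip: X_def)
  have lrw: "l + r < 2 ^ w" using lr lt_w by auto
  have "s = s0(6 := 1, 20 := X div 2 ^ \<phi>, 21 := 2 ^ \<phi> - 1, 4 := 2 ^ \<phi>, 5 := \<phi>,
      7 := fs ! 2, 8 := fs ! 3, 9 := fs ! 4, 10 := fs ! 5, 11 := fs ! 6, 12 := fs ! 7, 13 := fs ! 8,
      14 := fs ! 9, 15 := fs ! 10, 16 := fs ! 11, 17 := l + r)"
    unfolding s_def header_code_def fold_append o_apply part1
    using len(2) lrw s0 by (simp add: run_get c cell_nth)
  then show "frame s" "s 12 = fs ! 7" "s 13 = fs ! 8" "s 14 = fs ! 9" "s 15 = fs ! 10" "s 16 = fs ! 11"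
    using s0 by (simp_all add: frame_def hdr)
qed

lemma run_descend:
  fixes s0 :: "reg \<Rightarrow> nat"
  defines "s \<equiv> run descend_code s0" and "j \<equiv> s0 13 + 2 * entry (s0 15) (s0 14) l r"
  assumes s0: "frame s0" "s0 14 \<le> \<phi>" "s0 15 \<le> \<phi>" and j: "Suc j < length fs"
  shows "frame s" "s 12 = s0 12" "s 15 = s0 15" "s 13 = fs ! Suc j" "s 16 = fs ! j"
    "s 14 = s0 14 div 2"
proof -
  let ?d = "s0 14" and ?a = "s0 15"
  have e: "(?d div 2 + ?a) mod 2 ^ w = ?d div 2 + ?a"
    using s0 by (intro mod_less add_lt_w le_less_trans[OF _ phi_less]) auto
  have h: "binop_val w Sub ?d (?d div 2) = ?d - ?d div 2"
    using s0 by (intro binop_Sub lt_w le_less_trans[OF _ phi_less]) auto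
  have "?d - ?d div 2 < w" using s0 word phi by linarith
  then have H: "2 ^ (?d - ?d div 2) mod 2 ^ w = (2 ^ (?d - ?d div 2) :: nat)" by simp
  have "j < 2 ^ w" "Suc j < 2 ^ w" using j len lt_w by auto
  then have jm: "j mod 2 ^ w = j" "Suc j mod 2 ^ w = Suc j" by auto
  define x where "x = l div 2 ^ (?d div 2 + ?a) mod 2 ^ (?d - ?d div 2) * 2 ^ (?d - ?d div 2)"
  define y where "y = r div 2 ^ (?d div 2 + ?a) mod 2 ^ (?d - ?d div 2)"
  have j_alt: "x + y + (x + y) + s0 13 = j"
    by (simp add: j_def entry_def Let_def add.commute mult_2 x_def y_def)
  have part1: "run [Binop ShiftR 20 14 6, Binop Add 21 20 15, Binop Sub 22 14 20, Binop ShiftL 22 6 22,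
     Binop ShiftR 23 0 21, Binop Mod 23 23 22, Binop Mul 23 23 22,
     Binop ShiftR 24 1 21, Binop Mod 24 24 22, Binop Add 23 23 24, Binop Add 23 23 23,
     Binop Add 23 23 13] s0
    = s0(20 := ?d div 2, 21 := ?d div 2 + ?a, 22 := 2 ^ (?d - ?d div 2), 23 := j mod 2 ^ w, 24 := y)"
    using s0(1) e h H
    by (simp add: frame_def drop_bit_eq_div push_bit_eq_mult mod_simps fun_upd_twist
      del: binop_val.simps(2) flip: x_def y_def j_alt)
  have "s = s0(20 := ?d div 2, 21 := ?d div 2 + ?a, 22 := 2 ^ (?d - ?d div 2), 23 := Suc j, 24 := y,
      16 := cell j, 13 := cell (Suc j), 14 := ?d div 2)"
    unfolding s_def descend_code_def fold_append o_apply part1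
    using s0(1) jm by (simp add: run_get frame_def drop_bit_eq_div fun_upd_twist)
  then show "frame s" "s 12 = s0 12" "s 15 = s0 15" "s 13 = fs ! Suc j" "s 16 = fs ! j"
    "s 14 = s0 14 div 2"
    using s0 j by (auto simp: frame_def cell_nth)
qed


text \<open>
  If the probed frequency exceeds \<open>m\<close>, the rank lookup returns garbage, which the comparison with
  \<open>Suc m\<close> masks out.
\<close>

lemma run_search:
  fixes s0 :: "reg \<Rightarrow> nat"
  defines "s \<equiv> run search_code s0"
  assumes s0: "frame s0" "s0 16 \<le> f" "s0 12 < 2 ^ \<phi>"
  shows "frame s" "s 12 = s0 12 div 2"
    "s 16 = (if s0 16 + s0 12 \<le> f then s0 16 + s0 12 else s0 16)"
proof -
  include bit_operations_syntax
  let ?k = "s0 16 + s0 12"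
  have fm': "f < 2 ^ \<phi>" using fm nth_less[of 6] len hdr by simp
  then have k: "?k mod 2 ^ w = ?k" using s0 by (intro mod_less add_lt_w) auto
  have "frame (s0(24 := ?k))" using s0 by (simp add: frame_def)
  from run_rank[OF this, of 25 24 17] obtain u0 u1 u2 u3 v where
    v: "run (rank_code 25 24 17) (s0(24 := ?k)) =
        s0(24 := ?k, 20 := u0, 21 := u1, 22 := u2, 23 := u3, 25 := v)"
    and "?k \<le> m \<longrightarrow> s0 17 < 2 * n \<longrightarrow> v = G ?k (s0 17)" by auto
  moreover have "s0 17 = l + r" using s0 by (simp add: frame_def)
  ultimately have vG: "?k \<le> m \<longrightarrow> v = G ?k (l + r)" using lr by simp
  define c :: nat where "c = of_bool (l < v) AND of_bool (?k < Suc m)"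
  have c: "c = of_bool (l < v \<and> ?k < Suc m)" by (simp add: c_def)
  have "s = s0(24 := ?k, 20 := u0, 21 := u1, 22 := u2, 23 := u3, 25 := c * s0 12 mod 2 ^ w,
    26 := of_bool (?k < Suc m), 16 := (s0 16 + c * s0 12) mod 2 ^ w, 12 := s0 12 div 2)"
    unfolding s_def search_code_def fold_append o_apply fold_simps
    using s0(1)
    by (simp add: v k frame_def drop_bit_eq_div mod_simps fun_upd_twist flip: c_def)
  moreover have "(s0 16 + c * s0 12) mod 2 ^ w = (if ?k \<le> f then ?k else s0 16)"
  \<comment> \<open>A zero step may probe frequency 0, to which \<open>Gf\<close> does not apply;
    nothing is added then.\<close>
  proof (cases "s0 12 = 0")
    case True
    then show ?thesis using k by simp
  next
    case False
    then have "c = of_bool (?k \<le> f)" using c vG Gf[of ?k] fm by auto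
    then show ?thesis using k s0(2) fm' lt_w[of "s0 16"] by simp
  qed
  ultimately show "frame s" "s 12 = s0 12 div 2"
    "s 16 = (if s0 16 + s0 12 \<le> f then s0 16 + s0 12 else s0 16)"
    using s0(1) by (auto simp: frame_def)
qed

lemma run_witness:
  fixes s0 :: "reg \<Rightarrow> nat"
  defines "s \<equiv> run witness_code s0" and "g \<equiv> G f (l + r)" and "g' \<equiv> G f (l + r + 1)"
  assumes s0: "frame s0" "s0 16 = f"
  shows "s 27 = g' - g" "s 25 = g - 1" "s 26 = l + r - (g - 1)"
proof -
  have t: "(l + r + 1) mod 2 ^ w = l + r + 1" using lr lt_w[of "l + r + 1"] by simp
  from run_rank[OF s0(1), of 25 16 17] obtain u0 u1 u2 u3 v where
    v: "run (rank_code 25 16 17) s0 = s0(20 := u0, 21 := u1, 22 := u2, 23 := u3, 25 := v)"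
    and "s0 16 \<le> m \<longrightarrow> s0 17 < 2 * n \<longrightarrow> v = G (s0 16) (s0 17)" by auto
  moreover have s17: "s0 17 = l + r" "s0 6 = 1" using s0 by (simp_all add: frame_def)
  ultimately have v: "run (rank_code 25 16 17) s0 = s0(20 := u0, 21 := u1, 22 := u2, 23 := u3, 25 := g)"
    using lr s0(2) fm by (simp add: g_def)
  let ?s1 = "s0(20 := u0, 21 := u1, 22 := u2, 23 := u3, 25 := g, 26 := l + r + 1)"
  have "frame ?s1" using s0 by (simp add: frame_def)
  from run_rank[OF this, of 27 16 26] obtain u0 u1 u2 u3 v' where
    v': "run (rank_code 27 16 26) ?s1 = ?s1(20 := u0, 21 := u1, 22 := u2, 23 := u3, 27 := v')"
    and "?s1 16 \<le> m \<longrightarrow> ?s1 26 < 2 * n \<longrightarrow> v' = G (?s1 16) (?s1 26)" by auto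
  then have v'g: "v' = g'" using lr s0(2) fm by (simp add: g'_def)
  have "g' < 2 ^ \<phi>" "g < 2 ^ \<phi>" using rank[OF fm, of "l + r"] rank[OF fm, of "l + r + 1"] lr
    by (auto simp: g_def g'_def Let_def)
  then have b: "g < 2 ^ w" "g' < 2 ^ w" by (auto intro: lt_w)
  have g: "g \<le> g'" "g - 1 \<le> l + r" "1 \<le> g" using Gdiag[of f "l + r"] Gf[OF f0]
    by (auto simp: g_def g'_def)
  have lrw: "l + r < 2 ^ w" using lr lt_w by auto
  have "s = ?s1(20 := u0, 21 := u1, 22 := u2, 23 := u3, 27 := g' - g, 25 := g - 1,
      26 := l + r - (g - 1))"
    unfolding s_def witness_code_def fold_append o_apply v
    using v' g b lrw
    by (simp add: s17 t[simplified] v'g binop_Sub fun_upd_twist del: binop_val.simps(2))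
  then show "s 27 = g' - g" "s 25 = g - 1" "s 26 = l + r - (g - 1)" by auto
qed

lemma exec_descend:
  assumes "frame s" "s 12 = fs ! 7" "s 13 = fs ! 8" "s 14 = fs ! 9" "s 15 = fs ! 10" "s 16 = fs ! 11"
  shows "\<exists>t s'. exec w D T (WhileNZ 13 (block descend_code)) s t s' \<and> t \<le> iter1 * 22 + 1 \<and>
    frame s' \<and> s' 12 = fs ! 7 \<and> s' 16 \<le> f \<and> f < s' 16 + 2 * fs ! 7"
proof -
  define I where "I i s \<longleftrightarrow> frame s \<and> s 12 = fs ! 7 \<and> s 15 = fs ! 10 \<and> s 14 \<le> \<phi> \<and>
    search_path fs (fs ! 10) (fs ! 7) l r f i (s 13) (s 16) (s 14)" for i s
  have "\<exists>t s' j. exec w D T (WhileNZ 13 (block descend_code)) s t s' \<and> t \<le> iter1 * (21 + 1) + 1 \<and>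
      I j s' \<and> s' 13 = 0"
  proof (rule exec_while)
    show "I iter1 s" using assms path small_d by (simp add: I_def)
    fix i s assume I: "I i s" and p: "s 13 \<noteq> 0"
    obtain i' where i: "i = Suc i'" using I p by (cases i) (auto simp: I_def)
    define j where "j = s 13 + 2 * entry (s 15) (s 14) l r"
    have j: "Suc j < length fs"
      "search_path fs (fs ! 10) (fs ! 7) l r f i' (fs ! Suc j) (fs ! j) (s 14 div 2)"
      using I p by (auto simp: I_def i j_def Let_def)
    have s: "frame s" "s 14 \<le> \<phi>" "s 15 \<le> \<phi>" using I small_d by (auto simp: I_def)
    have "I i' (run descend_code s)"
      using run_descend[OF s j(1)[unfolded j_def], folded j_def] I j s(2) unfolding I_def by simp
    moreover have "exec w D T (block descend_code) s 21 (run descend_code s)"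
      using exec_block[of descend_code w D T s] by (simp add: code_instrs code_lengths)
    ultimately show "0 < i \<and> (\<exists>s'. exec w D T (block descend_code) s 21 s' \<and> I (i - 1) s')"
      using i by auto
  qed
  then obtain t s' j where "exec w D T (WhileNZ 13 (block descend_code)) s t s'"
    "t \<le> iter1 * 22 + 1" "I j s'" "s' 13 = 0" by auto
  then show ?thesis unfolding I_def by (cases j) auto
qed

lemma exec_search:
  assumes "frame s" "s 12 = fs ! 7" "s 16 \<le> f" "f < s 16 + 2 * fs ! 7"
  shows "\<exists>t s'. exec w D T (WhileNZ 12 (block search_code)) s t s' \<and> t \<le> iter2 * 29 + 1 \<and>
    frame s' \<and> s' 16 = f"
proof -
  \<comment> \<open>The step \<open>2 ^ i div 2\<close> vanishes exactly at \<open>i = 0\<close>,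
    where only one candidate for \<open>f\<close> is left.\<close>
  define I where "I i s \<longleftrightarrow> frame s \<and> s 12 = 2 ^ i div 2 \<and> s 12 < 2 ^ \<phi> \<and> s 16 \<le> f \<and>
    f < s 16 + 2 ^ i" for i s
  have "\<exists>t s' j. exec w D T (WhileNZ 12 (block search_code)) s t s' \<and> t \<le> iter2 * (28 + 1) + 1 \<and>
      I j s' \<and> s' 12 = 0"
  proof (rule exec_while)
    have "fs ! 7 < 2 ^ \<phi>" using nth_less len by auto
    then show "I iter2 s" using assms step by (cases iter2) (auto simp: I_def)
    fix i s assume I: "I i s" and p: "s 12 \<noteq> 0"
    obtain i' where i: "i = Suc i'" using I p by (cases i) (auto simp: I_def)
    have s: "frame s" "s 16 \<le> f" "s 12 < 2 ^ \<phi>" using I by (auto simp: I_def)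
    have "I i' (run search_code s)"
      using run_search[OF s] I i unfolding I_def by (auto intro: le_less_trans[OF div_le_dividend])
    moreover have "exec w D T (block search_code) s 28 (run search_code s)"
      using exec_block[of search_code w D T s] by (simp add: code_instrs code_lengths)
    ultimately show "0 < i \<and> (\<exists>s'. exec w D T (block search_code) s 28 s' \<and> I (i - 1) s')"
      using i by auto
  qed
  then obtain t s' j where *: "exec w D T (WhileNZ 12 (block search_code)) s t s'"
    "t \<le> iter2 * 29 + 1" "I j s'" "s' 12 = 0" by auto
  then have "j = 0" unfolding I_def by (cases j) auto
  then have "frame s'" "s' 16 = f" using *(3) unfolding I_def by auto
  with * show ?thesis by blast
qed

lemma exec_mode_query:
  assumes "s 0 = l" "s 1 = r" "s 4 = 0"
  shows "\<exists>t s'. exec w D T mode_query s t s' \<and> t \<le> 100 * (1 + iter1 + iter2) \<and>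
    s' 0 = read_char T (if G f (l + r + 1) = G f (l + r) then G f (l + r) - 1
      else l + r - (G f (l + r) - 1))"
proof -
  have 1: "exec w D T (block header_code) s 49 (run header_code s)"
    using exec_block[of header_code w D T s] by (simp add: code_instrs code_lengths)
  note h = run_header[OF assms]
  from exec_descend[OF h] obtain t2 s2 where
    2: "exec w D T (WhileNZ 13 (block descend_code)) (run header_code s) t2 s2" "t2 \<le> iter1 * 22 + 1"
    "frame s2" "s2 12 = fs ! 7" "s2 16 \<le> f" "f < s2 16 + 2 * fs ! 7" by blast
  from exec_search[OF 2(3-)] obtain t3 s3 where
    3: "exec w D T (WhileNZ 12 (block search_code)) s2 t3 s3" "t3 \<le> iter2 * 29 + 1"
    "frame s3" "s3 16 = f" by blast
  let ?s4 = "run witness_code s3"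
  have 4: "exec w D T (block witness_code) s3 45 ?s4"
    using exec_block[of witness_code w D T s3] by (simp add: code_instrs code_lengths)
  note wit = run_witness[OF 3(3,4)]
  let ?pos = "if G f (l + r + 1) = G f (l + r) then G f (l + r) - 1 else l + r - (G f (l + r) - 1)"
  have g: "G f (l + r) \<le> G f (l + r + 1)" using Gdiag[of f "l + r"] by simp
  have "exec w D T (IfNZ 27 (ReadChar 0 26) (ReadChar 0 25)) ?s4 (1 + 1) (?s4(0 := read_char T ?pos))"
  proof (cases "?s4 27 = 0")
    case True
    then have "?pos = ?s4 25" using wit g by simp
    then show ?thesis using exec.IfFalse[OF True exec.ReadChar[of w D T 0 25 ?s4]] by simp
  next
    case False
    then have "?pos = ?s4 26" using wit g by simp
    then show ?thesis using exec.IfTrue[OF False exec.ReadChar[of w D T 0 26 ?s4]] by simp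
  qed
  then have "exec w D T mode_query s (49 + (t2 + (t3 + (45 + (1 + 1))))) (?s4(0 := read_char T ?pos))"
    unfolding mode_query_def by (intro exec.Seq[OF 1] exec.Seq[OF 2(1)] exec.Seq[OF 3(1)] exec.Seq[OF 4])
  moreover have "49 + (t2 + (t3 + (45 + (1 + 1)))) \<le> 100 * (1 + iter1 + iter2)" using 2(2) 3(2) by simp
  ultimately show ?thesis by (metis fun_upd_same)
qed

end

section \<open>Allocation of memory\<close>

text \<open>Addresses are chosen before contents because node tables contain the addresses of other
  nodes.\<close>

lemma alloc:
  assumes "finite V"
  shows "\<exists>addr :: 'v \<Rightarrow> nat.
    (\<forall>v\<in>V. base \<le> addr v \<and> addr v + sz v \<le> base + sum sz V) \<and>
    (\<forall>content :: 'v \<Rightarrow> nat \<Rightarrow> 'c. \<exists>xs. length xs = sum sz V \<and>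
      (\<forall>x\<in>set xs. \<exists>v\<in>V. \<exists>j<sz v. x = content v j) \<and>
      (\<forall>v\<in>V. \<forall>j<sz v. xs ! (addr v - base + j) = content v j))"
  using assms
proof (induction V)
  case empty
  show ?case by simp
next
  case (insert u V)
  then obtain addr :: "'v \<Rightarrow> nat" where
    addr: "\<And>v. v \<in> V \<Longrightarrow> base \<le> addr v \<and> addr v + sz v \<le> base + sum sz V" and
    fill: "\<And>content :: 'v \<Rightarrow> nat \<Rightarrow> 'c. \<exists>xs. length xs = sum sz V \<and>
      (\<forall>x\<in>set xs. \<exists>v\<in>V. \<exists>j<sz v. x = content v j) \<and>
      (\<forall>v\<in>V. \<forall>j<sz v. xs ! (addr v - base + j) = content v j)"
    by blast
  let ?addr = "addr(u := base + sum sz V)"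
  have "\<exists>xs. length xs = sum sz (insert u V) \<and>
      (\<forall>x\<in>set xs. \<exists>v\<in>insert u V. \<exists>j<sz v. x = content v j) \<and>
      (\<forall>v\<in>insert u V. \<forall>j<sz v. xs ! (?addr v - base + j) = content v j)"
    for content :: "'v \<Rightarrow> nat \<Rightarrow> 'c"
  proof -
    obtain xs where xs: "length xs = sum sz V" "\<forall>x\<in>set xs. \<exists>v\<in>V. \<exists>j<sz v. x = content v j"
      "\<forall>v\<in>V. \<forall>j<sz v. xs ! (addr v - base + j) = content v j"
      using fill[of content] by blast
    let ?xs = "xs @ map (content u) [0..<sz u]"
    have "?xs ! (?addr v - base + j) = content v j" if "v \<in> insert u V" "j < sz v" for v j
    proof (cases "v = u")
      case True
      then show ?thesis using xs(1) that by (simp add: nth_append)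
    next
      case False
      then have "addr v - base + j < length xs" using addr[of v] that xs(1) by auto
      then show ?thesis using False that xs(3) by (simp add: nth_append)
    qed
    moreover have "length ?xs = sum sz (insert u V)" using insert xs by simp
    moreover have "\<forall>x\<in>set ?xs. \<exists>v\<in>insert u V. \<exists>j<sz v. x = content v j" using xs(2) by auto
    ultimately show ?thesis by blast
  qed
  moreover have "\<forall>v\<in>insert u V. base \<le> ?addr v \<and> ?addr v + sz v \<le> base + sum sz (insert u V)"
  proof
    fix v assume "v \<in> insert u V"
    then show "base \<le> ?addr v \<and> ?addr v + sz v \<le> base + sum sz (insert u V)"
      using insert.hyps addr[of v] by (cases "v = u") auto
  qed
  ultimately show ?case by blast
qed

section \<open>Approximating the mode frequency\<close>

text \<open>Monotonicity puts the extreme values at opposite corners: the minimum at the largest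
  \<open>l\<close> and least \<open>r\<close>, the maximum at the least \<open>l\<close> and largest
  \<open>r\<close>.\<close>

definition square_min :: "'a list \<Rightarrow> nat \<Rightarrow> nat \<Rightarrow> nat \<Rightarrow> nat" where
  "square_min S e x y = mfreq S (x * 2 ^ e + (2 ^ e - 1)) (y * 2 ^ e)"

definition square_max :: "'a list \<Rightarrow> nat \<Rightarrow> nat \<Rightarrow> nat \<Rightarrow> nat" where
  "square_max S e x y = mfreq S (x * 2 ^ e) (y * 2 ^ e + (2 ^ e - 1))"

lemma mfreq_square:
  "square_min S e (l div 2 ^ e) (r div 2 ^ e) \<le> mfreq S l r"
  "mfreq S l r \<le> square_max S e (l div 2 ^ e) (r div 2 ^ e)"
proof -
  have *: "x div 2 ^ e * 2 ^ e \<le> x" "x \<le> x div 2 ^ e * 2 ^ e + (2 ^ e - 1)" for x :: nat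
  proof -
    have "x mod 2 ^ e < 2 ^ e" by simp
    then have "x mod 2 ^ e \<le> 2 ^ e - 1" by linarith
    then show "x \<le> x div 2 ^ e * 2 ^ e + (2 ^ e - 1)"
      using div_mult_mod_eq[of x "2 ^ e"] by linarith
  qed simp
  show "square_min S e (l div 2 ^ e) (r div 2 ^ e) \<le> mfreq S l r"
    unfolding square_min_def by (rule mfreq_mono) (use * in auto)
  show "mfreq S l r \<le> square_max S e (l div 2 ^ e) (r div 2 ^ e)"
    unfolding square_max_def by (rule mfreq_mono) (use * in auto)
qed

text \<open>The corners differ by \<open>2 ^ e - 1\<close> in each coordinate. This bounds the error
  at a leaf of side \<open>2 ^ a\<close>.\<close>

lemma square_max_le: "square_max S e x y \<le> square_min S e x y + 2 * (2 ^ e - 1)"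
  unfolding square_max_def square_min_def
  using mfreq_add[of S "x * 2 ^ e" "y * 2 ^ e" "2 ^ e - 1" "2 ^ e - 1"] by (simp add: mult_2)

definition active :: "'a list \<Rightarrow> nat \<Rightarrow> nat \<Rightarrow> (nat \<times> nat) set" where
  "active S e X = {(x, y). x < X \<and> y < X \<and> square_min S e x y < square_max S e x y}"

lemma finite_active: "finite (active S e X)"
  by (rule finite_subset[of _ "{..<X} \<times> {..<X}"]) (auto simp: active_def)

text \<open>
  Along an antidiagonal of squares the ranges of the mode frequency do not overlap, so that at
  most \<open>max_freq S\<close> of them are nontrivial.
\<close>

lemma card_active: "card (active S e X) \<le> 2 * X * max_freq S"
proof -
  let ?f = "\<lambda>(x, y). (x + y, square_min S e x y)"
  have less: "square_min S e x2 y2 < square_min S e x1 y1"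
    if "x1 < x2" "x1 + y1 = x2 + y2" "(x2, y2) \<in> active S e X" for x1 y1 x2 y2
  proof -
    have step: "u * 2 ^ e + (2 ^ e - 1) \<le> v * 2 ^ e" if "u < v" for u v :: nat
    proof -
      have "Suc u * 2 ^ e \<le> v * 2 ^ e" using that by (intro mult_right_mono) auto
      then show ?thesis by simp
    qed
    \<comment> \<open>Since \<open>x1 < x2\<close> and \<open>y2 < y1\<close>, every interval of the
      second square lies inside every interval of the first.\<close>
    have "square_max S e x2 y2 \<le> square_min S e x1 y1"
      unfolding square_max_def square_min_def
      using that by (intro mfreq_mono step) auto
    then show ?thesis using that by (auto simp: active_def)
  qed
  have "inj_on ?f (active S e X)"
  proof (rule inj_onI, clarify)
    fix x1 y1 x2 y2
    assume *: "(x1, y1) \<in> active S e X" "(x2, y2) \<in> active S e X" "x1 + y1 = x2 + y2"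
      "square_min S e x1 y1 = square_min S e x2 y2"
    then show "x1 = x2 \<and> y1 = y2"
      using less[of x1 x2 y1 y2] less[of x2 x1 y2 y1] by (cases x1 x2 rule: linorder_cases) auto
  qed
  moreover have "?f ` active S e X \<subseteq> {..<2 * X} \<times> {..<max_freq S}"
    using mfreq_le_max_freq by (auto simp: active_def square_max_def intro: less_le_trans)
  ultimately have "card (active S e X) \<le> card ({..<2 * X} \<times> {..<max_freq S})"
    by (intro card_inj_on_le) auto
  then show ?thesis by (simp add: mult.commute)
qed

text \<open>
  A node \<open>(i, x, y)\<close> is a square of side \<open>2 ^ (a + d)\<close> with \<open>d = d0 div 2 ^ i\<close>.  Its table lists, for each
  subsquare of side \<open>2 ^ (a + d div 2)\<close>, the minimal mode frequency and the address of the child.  As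
  the exponent \<open>d\<close> is halved at each level, the tree has height \<open>O(log d0)\<close>, and every level has
  \<open>O(m * 2 ^ d0)\<close> entries.
\<close>

definition nodes :: "'a list \<Rightarrow> nat \<Rightarrow> nat \<Rightarrow> (nat \<times> nat \<times> nat) set" where
  "nodes S a d0 = Sigma {i. i < d0 \<and> 0 < d0 div 2 ^ i}
     (\<lambda>i. active S (a + d0 div 2 ^ i) (2 ^ (d0 - d0 div 2 ^ i)))"

definition node_size :: "nat \<Rightarrow> nat \<times> nat \<times> nat \<Rightarrow> nat" where
  "node_size d0 v = (let d = d0 div 2 ^ fst v in 2 * (2 ^ (d - d div 2) * 2 ^ (d - d div 2)))"

lemma finite_nodes: "finite (nodes S a d0)"
  unfolding nodes_def by (rule finite_SigmaI) (auto simp: finite_active)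

text \<open>By \<open>card_active\<close>, a level with exponent \<open>d\<close> has at most
  \<open>2 * 2 ^ (d0 - d) * max_freq S\<close> tables of \<open>2 * 2 ^ (2 * (d - d div 2))\<close>
  cells, and \<open>2 * (d - d div 2) \<le> d + 1\<close>. The number of levels is bounded crudely
  by \<open>d0\<close>.\<close>

lemma sum_node_size: "sum (node_size d0) (nodes S a d0) \<le> d0 * (8 * max_freq S * 2 ^ d0)"
proof -
  let ?I = "{i. i < d0 \<and> 0 < d0 div 2 ^ i}"
  let ?A = "\<lambda>i. active S (a + d0 div 2 ^ i) (2 ^ (d0 - d0 div 2 ^ i))"
  have "sum (node_size d0) (nodes S a d0) = (\<Sum>i\<in>?I. \<Sum>xy\<in>?A i. node_size d0 (i, xy))"
    unfolding nodes_def by (subst sum.Sigma) (auto simp: finite_active)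
  also have "\<dots> \<le> (\<Sum>i\<in>?I. 8 * max_freq S * 2 ^ d0)"
  proof (rule sum_mono)
    fix i
    define d where "d = d0 div 2 ^ i"
    have d: "d \<le> d0" by (simp add: d_def)
    have "(\<Sum>xy\<in>?A i. node_size d0 (i, xy)) = card (?A i) * (2 * 2 ^ (2 * (d - d div 2)))"
      by (simp add: node_size_def Let_def d_def flip: power_add mult_2)
    also have "\<dots> \<le> (2 * 2 ^ (d0 - d) * max_freq S) * (2 * 2 ^ (2 * (d - d div 2)))"
      unfolding d_def by (intro mult_right_mono card_active) simp
    also have "\<dots> = 4 * max_freq S * 2 ^ (d0 - d + 2 * (d - d div 2))"
      by (simp add: power_add)
    also have "\<dots> \<le> 4 * max_freq S * 2 ^ Suc d0"
    proof (intro mult_left_mono power_increasing)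
      have "d < 2 * (d div 2) + 2" by linarith
      then show "d0 - d + 2 * (d - d div 2) \<le> Suc d0" using d by linarith
    qed auto
    finally show "(\<Sum>xy\<in>?A i. node_size d0 (i, xy)) \<le> 8 * max_freq S * 2 ^ d0" by simp
  qed
  also have "\<dots> = card ?I * (8 * max_freq S * 2 ^ d0)" by simp
  also have "\<dots> \<le> d0 * (8 * max_freq S * 2 ^ d0)"
  proof (rule mult_right_mono)
    have "card ?I \<le> card {..<d0}" by (rule card_mono) auto
    then show "card ?I \<le> d0" by simp
  qed simp
  finally show ?thesis .
qed

definition node_content ::
  "'a list \<Rightarrow> nat \<Rightarrow> nat \<Rightarrow> (nat \<times> nat \<times> nat \<Rightarrow> nat) \<Rightarrow> nat \<times> nat \<times> nat \<Rightarrow> nat \<Rightarrow> nat" where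
  "node_content S a d0 ptr v j = (case v of (i, x, y) \<Rightarrow>
     let d = d0 div 2 ^ i; h = d - d div 2; x' = x * 2 ^ h + j div 2 div 2 ^ h;
       y' = y * 2 ^ h + j div 2 mod 2 ^ h in
     if even j then square_min S (a + d div 2) x' y' else ptr (Suc i, x', y'))"

text \<open>A square without a table is either inactive, with constant mode frequency, or has side
  \<open>2 ^ a\<close>; both keep the error below \<open>2 * 2 ^ a\<close>. Otherwise the table
  leads to the subsquare containing \<open>(l, r)\<close>, and halving the exponent ends the descent
  within \<open>k\<close> steps.\<close>

lemma search_path_nodes:
  fixes S :: "'a list" and l r a d0 :: nat
  defines "x i \<equiv> l div 2 ^ (a + d0 div 2 ^ i)" and "y i \<equiv> r div 2 ^ (a + d0 div 2 ^ i)"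
  assumes lr: "l < 2 ^ (a + d0)" "r < 2 ^ (a + d0)"
    and ptr: "\<And>v. v \<notin> nodes S a d0 \<Longrightarrow> ptr v = 0"
    and mem: "\<And>v j. v \<in> nodes S a d0 \<Longrightarrow> j < node_size d0 v \<Longrightarrow>
      0 < ptr v \<and> ptr v + j < length fs \<and> fs ! (ptr v + j) = node_content S a d0 ptr v j"
  shows "d0 div 2 ^ i < 2 ^ k \<Longrightarrow> search_path fs a (2 ^ a) l r (mfreq S l r) k (ptr (i, x i, y i))
    (square_min S (a + d0 div 2 ^ i) (x i) (y i)) (d0 div 2 ^ i)"
proof -
  have leaf: "ptr (i, x i, y i) = 0 \<and> square_min S (a + d0 div 2 ^ i) (x i) (y i) \<le> mfreq S l r \<and>
      mfreq S l r < square_min S (a + d0 div 2 ^ i) (x i) (y i) + 2 * 2 ^ a"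
    if "(i, x i, y i) \<notin> nodes S a d0" for i
  proof -
    let ?d = "d0 div 2 ^ i"
    note mfreq_square(1)[of S "a + ?d" l r, folded x_def y_def]
    moreover note mfreq_square(2)[of S l r "a + ?d", folded x_def y_def]
    moreover have "square_max S (a + ?d) (x i) (y i) < square_min S (a + ?d) (x i) (y i) + 2 * 2 ^ a"
    proof (cases "?d = 0")
      case True
      then show ?thesis using square_max_le[of S a "x i" "y i"]
        by (auto intro: le_less_trans)
    next
      case False
      then have "2 ^ i \<le> d0" by (metis div_less not_less)
      then have "i < d0" using less_exp[of i] by linarith
      moreover have "2 ^ (a + d0) = (2 ^ (d0 - ?d) * 2 ^ (a + ?d) :: nat)"
        by (simp flip: power_add)
      then have "x i < 2 ^ (d0 - ?d)" "y i < 2 ^ (d0 - ?d)"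
        using lr unfolding x_def y_def by (simp_all add: less_mult_imp_div_less)
      ultimately have "\<not> square_min S (a + ?d) (x i) (y i) < square_max S (a + ?d) (x i) (y i)"
        using that False by (auto simp: nodes_def active_def)
      moreover have "(0 :: nat) < 2 ^ a" by simp
      ultimately show ?thesis by linarith
    qed
    ultimately show ?thesis using ptr[OF that] by linarith
  qed
  show "d0 div 2 ^ i < 2 ^ k \<Longrightarrow> search_path fs a (2 ^ a) l r (mfreq S l r) k (ptr (i, x i, y i))
    (square_min S (a + d0 div 2 ^ i) (x i) (y i)) (d0 div 2 ^ i)"
  proof (induction k arbitrary: i)
    case (0 i)
    then have "(i, x i, y i) \<notin> nodes S a d0" by (auto simp: nodes_def)
    then show ?case using leaf by simp
  next
    case (Suc k i)
    show ?case
    proof (cases "(i, x i, y i) \<in> nodes S a d0")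
      case False
      then show ?thesis using leaf[OF False] by simp
    next
      case True
      define d where "d = d0 div 2 ^ i"
      define h where "h = d - d div 2"
      define e where "e = entry a d l r"
      have d2: "d div 2 = d0 div 2 ^ Suc i" by (simp only: d_def power_Suc2 div_mult2_eq)
      \<comment> \<open>The \<open>h\<close> digits used by \<open>entry\<close> extend the
        coordinate of a square to that of its subsquare.\<close>
      have up: "z div 2 ^ (a + d) * 2 ^ h + z div 2 ^ (a + d div 2) mod 2 ^ h = z div 2 ^ (a + d div 2)"
        for z :: nat
      proof -
        have *: "a + d = (a + d div 2) + h" by (simp add: h_def)
        have "z div 2 ^ (a + d) = z div 2 ^ (a + d div 2) div 2 ^ h"
          by (subst *) (simp only: power_add[of _ "a + d div 2" h] div_mult2_eq)
        then show ?thesis by (simp only: div_mult_mod_eq)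
      qed
      have e_eq: "e = l div 2 ^ (a + d div 2) mod 2 ^ h * 2 ^ h + r div 2 ^ (a + d div 2) mod 2 ^ h"
        by (simp add: e_def entry_def h_def Let_def)
      then have e_div: "e div 2 ^ h = l div 2 ^ (a + d div 2) mod 2 ^ h"
        "e mod 2 ^ h = r div 2 ^ (a + d div 2) mod 2 ^ h" by simp_all
      have "e div 2 ^ h < 2 ^ h" unfolding e_div by simp
      then have "e < 2 ^ h * 2 ^ h" by (simp add: div_less_iff_less_mult)
      then have sz: "2 * e < node_size d0 (i, x i, y i)" "Suc (2 * e) < node_size d0 (i, x i, y i)"
        by (simp_all add: node_size_def Let_def flip: d_def h_def)
      have xy: "x i * 2 ^ h + e div 2 ^ h = x (Suc i)" "y i * 2 ^ h + e mod 2 ^ h = y (Suc i)"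
        using up[of l] up[of r] by (simp_all only: e_div x_def y_def flip: d_def d2)
      have "fs ! (ptr (i, x i, y i) + 2 * e) = square_min S (a + d div 2) (x (Suc i)) (y (Suc i))"
        using mem[OF True sz(1)] xy by (simp add: node_content_def Let_def flip: d_def h_def)
      moreover have "fs ! Suc (ptr (i, x i, y i) + 2 * e) = ptr (Suc i, x (Suc i), y (Suc i))"
        using mem[OF True sz(2)] xy by (simp add: node_content_def Let_def flip: d_def h_def)
      moreover have "d div 2 < 2 ^ k" using Suc.prems by (simp add: d_def)
      then have "search_path fs a (2 ^ a) l r (mfreq S l r) k (ptr (Suc i, x (Suc i), y (Suc i)))
         (square_min S (a + d div 2) (x (Suc i)) (y (Suc i))) (d div 2)"
        using Suc.IH[of "Suc i"] by (simp only: d2)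
      ultimately show ?thesis
        using mem[OF True sz(2)] Suc.prems by (simp add: Let_def flip: d_def e_def)
    qed
  qed
qed

text \<open>The tables \<open>xs\<close> may sit in any memory from \<open>base\<close> on. A
  positive \<open>base\<close> keeps address 0 free to mark leaves.\<close>

lemma nodes_memory:
  fixes S :: "'a list" and a d0 base k :: nat
  assumes base: "0 < base" and k: "d0 < 2 ^ k"
  shows "\<exists>xs p v. length xs \<le> d0 * (8 * max_freq S * 2 ^ d0) \<and>
    (\<forall>x\<in>set xs. x \<le> max_freq S \<or> x \<le> base + length xs) \<and> p \<le> base + length xs \<and> v \<le> max_freq S \<and>
    (\<forall>fs l r. (\<forall>i<length xs. base + i < length fs \<and> fs ! (base + i) = xs ! i) \<longrightarrow>
      l < 2 ^ (a + d0) \<longrightarrow> r < 2 ^ (a + d0) \<longrightarrow>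
      search_path fs a (2 ^ a) l r (mfreq S l r) k p v d0)"
proof -
  let ?V = "nodes S a d0" and ?sz = "node_size d0"
  obtain addr where addr: "\<And>v. v \<in> ?V \<Longrightarrow> base \<le> addr v \<and> addr v + ?sz v \<le> base + sum ?sz ?V"
    and fill: "\<And>content :: nat \<times> nat \<times> nat \<Rightarrow> nat \<Rightarrow> nat. \<exists>xs. length xs = sum ?sz ?V \<and>
      (\<forall>x\<in>set xs. \<exists>v\<in>?V. \<exists>j<?sz v. x = content v j) \<and>
      (\<forall>v\<in>?V. \<forall>j<?sz v. xs ! (addr v - base + j) = content v j)"
    using alloc[where 'c = nat, OF finite_nodes[of S a d0], of base ?sz] by blast
  define ptr where "ptr v = (if v \<in> ?V then addr v else 0)" for v
  obtain xs where xs: "length xs = sum ?sz ?V"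
      "\<forall>x\<in>set xs. \<exists>v\<in>?V. \<exists>j<?sz v. x = node_content S a d0 ptr v j"
      "\<forall>v\<in>?V. \<forall>j<?sz v. xs ! (addr v - base + j) = node_content S a d0 ptr v j"
    using fill by blast
  have ptr_le: "ptr v \<le> base + length xs" for v
    using addr[of v] xs(1) by (auto simp: ptr_def)
  have min_le: "square_min S e x y \<le> max_freq S" for e x y
    unfolding square_min_def by (rule mfreq_le_max_freq)
  have bound: "\<forall>x\<in>set xs. x \<le> max_freq S \<or> x \<le> base + length xs"
  proof
    fix x assume "x \<in> set xs"
    then obtain v j where "x = node_content S a d0 ptr v j" using xs(2) by blast
    then show "x \<le> max_freq S \<or> x \<le> base + length xs"
      using ptr_le min_le by (cases v) (auto simp: node_content_def Let_def)
  qed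
  have path: "search_path fs a (2 ^ a) l r (mfreq S l r) k (ptr (0, 0, 0)) (square_min S (a + d0) 0 0) d0"
    if fs: "\<forall>i<length xs. base + i < length fs \<and> fs ! (base + i) = xs ! i"
      and lr: "l < 2 ^ (a + d0)" "r < 2 ^ (a + d0)" for fs l r
  proof -
    have mem: "0 < ptr v \<and> ptr v + j < length fs \<and> fs ! (ptr v + j) = node_content S a d0 ptr v j"
      if v: "v \<in> ?V" "j < ?sz v" for v j
    proof -
      define t where "t = addr v - base + j"
      have "t < length xs" "addr v + j = base + t"
        using addr[OF v(1)] v(2) xs(1) by (auto simp: t_def)
      moreover have "xs ! t = node_content S a d0 ptr v j" using xs(3) v unfolding t_def by blast
      ultimately show ?thesis using fs v(1) base addr[OF v(1)] by (auto simp: ptr_def)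
    qed
    have ptr0: "ptr v = 0" if "v \<notin> ?V" for v using that by (simp add: ptr_def)
    have "search_path fs a (2 ^ a) l r (mfreq S l r) k
      (ptr (0, l div 2 ^ (a + d0 div 2 ^ 0), r div 2 ^ (a + d0 div 2 ^ 0)))
      (square_min S (a + d0 div 2 ^ 0) (l div 2 ^ (a + d0 div 2 ^ 0)) (r div 2 ^ (a + d0 div 2 ^ 0)))
      (d0 div 2 ^ 0)"
      by (rule search_path_nodes[OF lr]) (use mem ptr0 k in auto)
    then show ?thesis using lr by simp
  qed
  have "length xs \<le> d0 * (8 * max_freq S * 2 ^ d0)" using sum_node_size xs(1) by simp
  then show ?thesis using bound ptr_le min_le path by blast
qed

section \<open>The rank directory\<close>

definition path_bit :: "'a list \<Rightarrow> nat \<Rightarrow> nat \<Rightarrow> nat" where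
  "path_bit S k t = (case t of 0 \<Rightarrow> diag S k 0 | Suc t' \<Rightarrow> diag S k t - diag S k t')"

lemma path_bit_le: "path_bit S k t \<le> 1"
  using diag_le[of S k 0] diag_Suc(2)[of S k] by (cases t) (auto simp: path_bit_def le_diff_conv)

lemma sum_path_bit: "(\<Sum>i\<le>t. path_bit S k i) = diag S k t"
proof (induction t)
  case (Suc t)
  then show ?case using diag_Suc(1)[of S k t] by (simp add: path_bit_def)
qed (simp add: path_bit_def)

definition rank_sample :: "'a list \<Rightarrow> nat \<Rightarrow> nat \<Rightarrow> nat \<Rightarrow> nat" where
  "rank_sample S b k j = (\<Sum>i<j * b. path_bit S k i)"

definition rank_word :: "'a list \<Rightarrow> nat \<Rightarrow> nat \<Rightarrow> nat \<Rightarrow> nat" where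
  "rank_word S b k j = horner_sum of_bool 2 (map (\<lambda>i. path_bit S k (j * b + i) = 1) [0..<b])"

text \<open>The index packs a word and an offset into one number, so that a single table, shared by
  all \<open>k\<close>, completes every rank lookup.\<close>

definition popcount_entry :: "nat \<Rightarrow> nat \<Rightarrow> nat" where
  "popcount_entry b z = (\<Sum>i\<le>z mod b. of_bool (bit (z div b) i))"

lemma rank_sample_le: "rank_sample S b k j \<le> j * b"
proof -
  have "rank_sample S b k j \<le> (\<Sum>i<j * b. 1)"
    unfolding rank_sample_def by (intro sum_mono path_bit_le)
  then show ?thesis by simp
qed

lemma rank_word_less: "rank_word S b k j < 2 ^ b"
  unfolding rank_word_def
  by (rule less_le_trans[OF horner_sum_of_bool_2_less]) simp

lemma popcount_entry_le: "0 < b \<Longrightarrow> popcount_entry b z \<le> b"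
proof -
  assume "0 < b"
  have "popcount_entry b z \<le> (\<Sum>i\<le>z mod b. 1)"
    unfolding popcount_entry_def by (intro sum_mono) simp
  also have "\<dots> \<le> b" using \<open>0 < b\<close> by (simp add: Suc_leI)
  finally show ?thesis .
qed

text \<open>Two-level rank: the sum of path bits is split at the start of the block containing
  \<open>t\<close>.\<close>

lemma diag_eq_rank:
  assumes "0 < b"
  shows "diag S k t
    = rank_sample S b k (t div b) + popcount_entry b (rank_word S b k (t div b) * b + t mod b)"
proof -
  let ?j = "t div b" and ?o = "t mod b"
  have o: "?o < b" using assms by simp
  have "diag S k t = (\<Sum>i<?j * b + Suc ?o. path_bit S k i)"
    by (simp add: lessThan_Suc_atMost flip: sum_path_bit)
  also have "\<dots> = rank_sample S b k ?j + (\<Sum>i<Suc ?o. path_bit S k (?j * b + i))"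
  proof -
    have "(\<Sum>i<x + y. path_bit S k i) = (\<Sum>i<x. path_bit S k i) + (\<Sum>i<y. path_bit S k (x + i))" for x y
      by (induction y) simp_all
    then show ?thesis by (simp only: rank_sample_def)
  qed
  also have "(\<Sum>i<Suc ?o. path_bit S k (?j * b + i)) = (\<Sum>i<Suc ?o. of_bool (bit (rank_word S b k ?j) i))"
  proof (rule sum.cong)
    fix i assume "i \<in> {..<Suc ?o}"
    then have "i < b" using o by simp
    then have "bit (rank_word S b k ?j) i \<longleftrightarrow> path_bit S k (?j * b + i) = 1"
      by (simp add: rank_word_def bit_horner_sum_bit_iff)
    then show "path_bit S k (?j * b + i) = of_bool (bit (rank_word S b k ?j) i)"
      using path_bit_le[of S k "?j * b + i"] by auto
  qed simp
  also have "\<dots> = popcount_entry b (rank_word S b k ?j * b + ?o)"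
    using assms by (simp add: popcount_entry_def lessThan_Suc_atMost)
  finally show ?thesis .
qed

definition rank_cells :: "'a list \<Rightarrow> nat \<Rightarrow> nat \<Rightarrow> nat \<Rightarrow> nat list" where
  "rank_cells S b q m = map (\<lambda>z. let j = z mod q div 2 in
     if even (z mod q) then rank_sample S b (z div q) j else rank_word S b (z div q) j) [0..<Suc m * q]"

definition popcount_cells :: "nat \<Rightarrow> nat list" where
  "popcount_cells b = map (popcount_entry b) [0..<2 ^ b * b]"

lemma rank_cells_nth:
  assumes "k \<le> m" "2 * j + 1 < q" "even q"
  shows "k * q + 2 * j + 1 < length (rank_cells S b q m)"
    "rank_cells S b q m ! (k * q + 2 * j) = rank_sample S b k j"
    "rank_cells S b q m ! (k * q + 2 * j + 1) = rank_word S b k j"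
proof -
  have "k * q + (2 * j + 1) < k * q + q" using assms by simp
  also have "\<dots> = Suc k * q" by simp
  also have "\<dots> \<le> Suc m * q" using assms by (intro mult_right_mono) auto
  finally have *: "k * q + 2 * j + 1 < Suc m * q" by simp
  then show "k * q + 2 * j + 1 < length (rank_cells S b q m)" by (simp add: rank_cells_def)
  have 1: "(k * q + 2 * j) mod q = 2 * j" "(k * q + 2 * j) div q = k" using assms by auto
  then show "rank_cells S b q m ! (k * q + 2 * j) = rank_sample S b k j"
    using * by (simp add: rank_cells_def)
  have "k * q + 2 * j + 1 = (2 * j + 1) + q * k" by simp
  then have 2: "(k * q + 2 * j + 1) mod q = 2 * j + 1" "(k * q + 2 * j + 1) div q = k"
    using assms(2) by (simp_all only: mod_mult_self2 div_mult_self2 mod_less div_less)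
  then show "rank_cells S b q m ! (k * q + 2 * j + 1) = rank_word S b k j"
    unfolding rank_cells_def using * by (subst nth_map) (simp_all add: Let_def)
qed

lemma popcount_cells_nth:
  assumes "x < 2 ^ b" "i < b"
  shows "x * b + i < length (popcount_cells b)" "popcount_cells b ! (x * b + i) = popcount_entry b (x * b + i)"
proof -
  have "x * b + i < Suc x * b" using assms by simp
  also have "\<dots> \<le> 2 ^ b * b" using assms by (intro mult_right_mono) auto
  finally have "x * b + i < 2 ^ b * b" .
  then show "x * b + i < length (popcount_cells b)"
    "popcount_cells b ! (x * b + i) = popcount_entry b (x * b + i)" by (simp_all add: popcount_cells_def)
qed

section \<open>Size estimates and assembly of the memory\<close>

lemma square_le_two_power: "b * b \<le> 2 * 2 ^ b" for b :: nat
proof (cases "b < 3")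
  case True
  then have "b = 0 \<or> b = 1 \<or> b = 2" by auto
  then show ?thesis by auto
next
  case False
  then have "3 \<le> b" by simp
  then show ?thesis
  proof (induction b rule: dec_induct)
    case (step b)
    have "3 * b \<le> b * b" using step(1) by simp
    then have "2 * b + 1 \<le> b * b" using step(1) by linarith
    then show ?case using step(3) by simp
  qed simp
qed

text \<open>As \<open>\<phi>\<close> is linear in \<open>b\<close>, each of the \<open>Suc m\<close>
  rows of about \<open>4 * n div b\<close> cells takes O(n) bits. The popcount table takes O(n) bits
  as well, because \<open>b * b \<le> 2 * 2 ^ b\<close> and
  \<open>2 ^ (2 * b) \<le> 8 * n\<close>.\<close>

lemma size_bound:
  fixes n m E b \<phi> x :: nat
  assumes n: "0 < n" "n \<le> 2 ^ E" "2 ^ E < 2 * n" and m: "0 < m" "m \<le> n"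
    and b: "b = E div 2 + 1" and \<phi>: "\<phi> = 2 * E + 40" and x: "x * \<phi> \<le> 8 * n * m"
  defines "N \<equiv> 12 + Suc m * (2 * (2 * n div b + 1)) + 2 ^ b * b + x"
  shows "N * \<phi> \<le> 2 ^ 12 * n * m" "N < 2 ^ \<phi>"
proof -
  have \<phi>b: "\<phi> \<le> 44 * b" proof -
    have "E mod 2 < 2" by simp
    then have "E \<le> 2 * (E div 2) + 1" using mult_div_mod_eq[of 2 E] by linarith
    then show ?thesis by (simp add: \<phi> b)
  qed
  have "E < 2 ^ E" by simp
  then have "\<phi> \<le> 42 * 2 ^ E" unfolding \<phi> by linarith
  then have \<phi>n: "\<phi> \<le> 84 * n" using n by linarith
  have nm: "n \<le> n * m" using m by simp
  have "2 * n div b * \<phi> \<le> 2 * n div b * (44 * b)" using \<phi>b by (rule mult_left_mono) simp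
  also have "\<dots> = 44 * (2 * n div b * b)" by simp
  also have "\<dots> \<le> 44 * (2 * n)" by (intro mult_left_mono) auto
  finally have row: "2 * (2 * n div b + 1) * \<phi> \<le> 344 * n" using \<phi>n by (simp add: algebra_simps)
  have "Suc m * (2 * (2 * n div b + 1) * \<phi>) \<le> (2 * m) * (344 * n)"
    by (rule mult_le_mono[OF _ row]) (use m in simp)
  then have R: "Suc m * (2 * (2 * n div b + 1)) * \<phi> \<le> 688 * (n * m)" by (simp add: algebra_simps)
  have "2 ^ b * 2 ^ b = (2 ^ (2 * b) :: nat)" by (simp add: mult_2 power_add)
  also have "\<dots> \<le> 2 ^ (E + 2)" unfolding b by (intro power_increasing) auto
  also have "\<dots> \<le> 8 * n" using n by simp
  finally have bn: "2 ^ b * 2 ^ b \<le> 8 * n" .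
  have "2 ^ b * b * \<phi> \<le> 2 ^ b * b * (44 * b)" using \<phi>b by (rule mult_left_mono) simp
  also have "\<dots> = 44 * (2 ^ b * (b * b))" by simp
  also have "\<dots> \<le> 44 * (2 ^ b * (2 * 2 ^ b))"
    by (intro mult_left_mono square_le_two_power) auto
  also have "\<dots> \<le> 704 * n" using bn by simp
  finally have T: "2 ^ b * b * \<phi> \<le> 704 * n" .
  have "N * \<phi> = 12 * \<phi> + Suc m * (2 * (2 * n div b + 1)) * \<phi> + 2 ^ b * b * \<phi> + x * \<phi>"
    unfolding N_def by (simp only: distrib_right)
  \<comment> \<open>The four terms contribute at most 1008, 688, 704 and 8 times
    \<open>n * m\<close>.\<close>
  also have "\<dots> \<le> 4096 * (n * m)" using R T x \<phi>n nm by linarith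
  finally show 1: "N * \<phi> \<le> 2 ^ 12 * n * m" by simp
  have "N * 1 \<le> N * \<phi>" by (rule mult_le_mono2) (simp add: \<phi>)
  also note 1
  also have "2 ^ 12 * n * m \<le> 2 ^ 12 * 2 ^ E * 2 ^ E" using n m by (intro mult_le_mono) linarith+
  also have "\<dots> = 2 ^ (12 + E + E)" by (simp only: power_add)
  also have "\<dots> < 2 ^ \<phi>" unfolding \<phi> by (rule power_strict_increasing) auto
  finally show "N < 2 ^ \<phi>" by simp
qed

text \<open>\<open>xs\<close> is the approximation tree in memory. An empty list with
  \<open>iter = 0\<close> gives plain binary search, so both regimes of \<open>m\<close> share this
  lemma.\<close>

lemma structure_correct:
  fixes S :: "'a list" and code :: "'a \<Rightarrow> nat"
  defines "n \<equiv> length S" and "m \<equiv> max_freq S"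
  assumes n: "0 < n" "n \<le> 2 ^ E" "2 ^ E < 2 * n"
    and b: "b = E div 2 + 1" and \<phi>: "\<phi> = 2 * E + 40" and q: "q = 2 * (2 * n div b + 1)"
    and w: "4 * \<phi> \<le> w" and base: "base = 12 + Suc m * q + 2 ^ b * b"
    and xs: "length xs * \<phi> \<le> 8 * n * m" "\<And>x. x \<in> set xs \<Longrightarrow> x \<le> m \<or> x \<le> base + length xs"
    and pv: "p \<le> base + length xs" "v \<le> m" and ad: "a < \<phi>" "d0 \<le> \<phi>"
    and path: "\<And>fs l r. (\<And>i. i < length xs \<Longrightarrow> base + i < length fs \<and> fs ! (base + i) = xs ! i) \<Longrightarrow>
      l < n \<Longrightarrow> r < n \<Longrightarrow> search_path fs a (2 ^ a) l r (mfreq S l r) iter p v d0"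
  shows "\<exists>D. length D \<le> 2 ^ 12 * n * m \<and> (\<forall>l r. l \<le> r \<longrightarrow> r < n \<longrightarrow>
    reports_mode w code mode_query D S l r (real (100 * (2 + iter + a))))"
proof -
  define hdr where "hdr = [2 ^ (\<phi> - 1), \<phi>, b, q, 12, 12 + Suc m * q, Suc m, 2 ^ a, p, d0, a, v]"
  define R where "R = rank_cells S b q m"
  define fs where "fs = hdr @ R @ popcount_cells b @ xs"
  have len_hdr: "length hdr = 12" by (simp add: hdr_def)
  have len_R: "length R = Suc m * q" by (simp add: R_def rank_cells_def)
  have len_P: "length (popcount_cells b) = 2 ^ b * b" by (simp add: popcount_cells_def)
  have len: "length fs = base + length xs" by (simp only: fs_def length_append len_hdr len_R len_P base)
  have mn: "m \<le> n" unfolding m_def n_def by (rule max_freq_le_length)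
  have "0 < mfreq S 0 0" using n by (intro mfreq_pos) (auto simp: n_def)
  then have m0: "0 < m" using mfreq_le_max_freq[of S 0 0] by (simp add: m_def)
  have fs_len: "length fs * \<phi> \<le> 2 ^ 12 * n * m" "length fs < 2 ^ \<phi>"
    using size_bound[OF n m0 mn b \<phi> xs(1)] by (simp_all only: len base q)
  have b0: "0 < b" by (simp add: b)
  have big: "2 * n + 2 * n + 2 < 2 ^ \<phi>"
  proof -
    have "2 * n + 2 * n + 2 \<le> 6 * 2 ^ E" using n by linarith
    also have "\<dots> < 64 * 2 ^ E" by simp
    also have "\<dots> = 2 ^ (E + 6)" by (simp add: power_add)
    also have "\<dots> \<le> 2 ^ \<phi>" unfolding \<phi> by (intro power_increasing) auto
    finally show ?thesis .
  qed
  define nb where "nb = 2 * n div b"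
  have q_nb: "q = 2 * (nb + 1)" by (simp add: q nb_def)
  have "nb \<le> 2 * n" by (simp add: nb_def)
  then have qn: "q \<le> 2 * n + 2 * n + 2" unfolding q_nb by simp
  have half: "u div 2 \<le> nb" if "u < q" for u using that unfolding q_nb by simp
  have hdr_nth: "fs ! i = hdr ! i" if "i < 12" for i using that by (simp add: fs_def nth_append len_hdr)
  have R_nth: "fs ! (12 + i) = R ! i" if "i < length R" for i
    using that by (simp add: fs_def nth_append len_hdr)
  have P_nth: "fs ! (12 + Suc m * q + i) = popcount_cells b ! i" if "i < length (popcount_cells b)" for i
  proof -
    have "fs ! (length hdr + length R + i) = popcount_cells b ! i"
      using that unfolding fs_def by (simp add: nth_append)
    then show ?thesis by (simp only: len_hdr len_R)
  qed
  have xs_nth: "fs ! (base + i) = xs ! i" if "i < length xs" for i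
  proof -
    have "fs ! (length hdr + length R + length (popcount_cells b) + i) = xs ! i"
      using that unfolding fs_def by (simp add: nth_append)
    then show ?thesis by (simp only: len_hdr len_R len_P base)
  qed
  have phi_less: "z \<le> \<phi> \<Longrightarrow> z < 2 ^ \<phi>" for z by (rule le_less_trans) auto
  have cells: "z < 2 ^ \<phi>" if z: "z \<in> set fs" for z
  proof -
    have bE: "b \<le> \<phi>" by (simp add: b \<phi>)
    consider "z \<in> set hdr" | "z \<in> set R" | "z \<in> set (popcount_cells b)" | "z \<in> set xs"
      using z unfolding fs_def by auto
    then show ?thesis
    proof cases
      case 1
      have "\<phi> - 1 < \<phi>" "12 \<le> \<phi>" by (simp_all add: \<phi>)
      then have "(2 :: nat) ^ (\<phi> - 1) < 2 ^ \<phi>" "12 < (2 :: nat) ^ \<phi>" "(2 :: nat) ^ a < 2 ^ \<phi>"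
        using ad by (auto intro: power_strict_increasing phi_less)
      moreover have "12 + Suc m * q < 2 ^ \<phi>" "p < 2 ^ \<phi>"
        using fs_len(2) pv(1) unfolding len base by linarith+
      moreover have "Suc m < 2 ^ \<phi>" "q < 2 ^ \<phi>" "v < 2 ^ \<phi>"
        using big mn qn pv(2) by linarith+
      moreover have "\<phi> < 2 ^ \<phi>" "b < 2 ^ \<phi>" "d0 < 2 ^ \<phi>" "a < 2 ^ \<phi>"
        using ad bE by (auto intro: phi_less)
      ultimately show ?thesis using 1 unfolding hdr_def by auto
    next
      case 2
      then obtain y where y: "y < Suc m * q" and z: "z = (let j = y mod q div 2 in
         if even (y mod q) then rank_sample S b (y div q) j else rank_word S b (y div q) j)"
        unfolding R_def rank_cells_def by auto
      have "y mod q < q" using q by simp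
      then have "y mod q div 2 \<le> nb" by (rule half)
      then have "y mod q div 2 * b \<le> nb * b" by (rule mult_right_mono) simp
      also have "\<dots> \<le> 2 * n" by (simp add: nb_def)
      finally have "rank_sample S b (y div q) (y mod q div 2) \<le> 2 * n"
        using rank_sample_le order_trans by blast
      moreover have "(2 :: nat) ^ b \<le> 2 ^ \<phi>" using bE by (intro power_increasing) auto
      then have "rank_word S b (y div q) (y mod q div 2) < 2 ^ \<phi>" using rank_word_less less_le_trans by blast
      ultimately show ?thesis using z big by (auto simp: Let_def)
    next
      case 3
      then have "z \<le> b" using popcount_entry_le[OF b0] by (auto simp: popcount_cells_def)
      then show ?thesis using bE by (intro phi_less) simp
    next
      case 4
      then show ?thesis using xs(2)[OF 4] fs_len(2) big mn unfolding len by linarith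
    qed
  qed
  have "reports_mode w code mode_query (encode \<phi> fs) S l r (real (100 * (2 + iter + a)))"
    if lr: "l \<le> r" "r < n" for l r
  proof -
    \<comment> \<open>A binary search with first step \<open>2 ^ a\<close> takes
      \<open>Suc a\<close> rounds.\<close>
    interpret query_machine w \<phi> fs "map code S" l r n "mfreq S l r" m "diag S" b q 12 "12 + Suc m * q"
      iter "Suc a"
    proof
      show "fs ! 0 = 2 ^ (\<phi> - 1)" "fs ! 1 = \<phi>" "fs ! 2 = b" "fs ! 3 = q" "fs ! 4 = 12"
        "fs ! 5 = 12 + Suc m * q" "fs ! 6 = Suc m" "fs ! 7 = 2 ^ (Suc a - 1)" "fs ! 9 \<le> \<phi>" "fs ! 10 \<le> \<phi>"
        using ad by (simp_all add: hdr_nth, simp_all add: hdr_def)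
      have "fs ! 7 = 2 ^ a" "fs ! 8 = p" "fs ! 9 = d0" "fs ! 10 = a" "fs ! 11 = v"
        by (simp_all add: hdr_nth, simp_all add: hdr_def)
      then show "search_path fs (fs ! 10) (fs ! 7) l r (mfreq S l r) iter (fs ! 8) (fs ! 11) (fs ! 9)"
        using path[of fs l r] xs_nth len lr by simp
      fix k t assume k: "k \<le> m" and t: "t < 2 * n"
      let ?j = "t div b"
      have "?j \<le> nb" unfolding nb_def using t by (intro div_le_mono) simp
      then have j: "2 * ?j + 1 < q" unfolding q_nb by simp
      note rk = rank_cells_nth[OF k j, of S b, folded R_def]
      have eq: "even q" by (simp add: q)
      have pc: "rank_word S b k ?j * b + t mod b < length (popcount_cells b)"
        "popcount_cells b ! (rank_word S b k ?j * b + t mod b)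
          = popcount_entry b (rank_word S b k ?j * b + t mod b)"
        by (rule popcount_cells_nth[OF rank_word_less], simp add: b0)+
      have "fs ! (k * q + 2 * ?j + 12) = rank_sample S b k ?j"
        using rk[OF eq] R_nth[of "k * q + 2 * ?j"] by (simp add: add.commute)
      moreover have "fs ! Suc (k * q + 2 * ?j + 12) = rank_word S b k ?j"
        using rk[OF eq] R_nth[of "k * q + 2 * ?j + 1"] by (simp add: add.commute)
      moreover have "fs ! (rank_word S b k ?j * b + t mod b + (12 + Suc m * q))
          = popcount_entry b (rank_word S b k ?j * b + t mod b)"
        using P_nth[OF pc(1)] pc(2) by (simp only: add.commute[of "12 + Suc m * q"])
      moreover have "Suc (k * q + 2 * ?j + 12) < length fs"
        using rk(1)[OF eq] unfolding len base len_R by linarith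
      moreover have "rank_word S b k ?j * b + t mod b + (12 + Suc m * q) < length fs"
        using pc(1) unfolding len base len_P by linarith
      moreover have "diag S k t < 2 ^ \<phi>" using diag_le[of S k t] t big by linarith
      ultimately show "let i = k * q + 2 * (t div b) + 12; j = fs ! Suc i * b + t mod b + (12 + Suc m * q)
        in Suc i < length fs \<and> j < length fs \<and> fs ! i + fs ! j = diag S k t \<and> diag S k t < 2 ^ \<phi>"
        using diag_eq_rank[OF b0, of S k t] by (simp add: Let_def)
    next
      show "4 * \<phi> \<le> w" by (rule w)
      show "0 < \<phi>" by (simp add: \<phi>)
      show "\<And>z. z \<in> set fs \<Longrightarrow> z < 2 ^ \<phi>" by (rule cells)
      show "length fs < 2 ^ \<phi>" by (rule fs_len)
      show "11 < length fs" by (simp add: len base)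
      show "0 < b" by (rule b0)
      show "l \<le> r" "r < n" by (rule lr)+
      show "2 * n < 2 ^ \<phi>" using big by simp
      show "\<And>k. 0 < k \<Longrightarrow> l < diag S k (l + r) \<longleftrightarrow> k \<le> mfreq S l r" by (simp add: less_diag_iff)
      show "mfreq S l r \<le> m" by (simp add: m_def mfreq_le_max_freq)
      show "0 < mfreq S l r" using lr by (intro mfreq_pos) (auto simp: n_def)
      show "\<And>k t. diag S k t \<le> diag S k (Suc t)" "\<And>k t. diag S k t \<le> Suc t"
        by (rule diag_Suc diag_le)+
      show "0 < Suc a" by simp
    qed
    define pos where "pos = (if diag S (mfreq S l r) (l + r + 1) = diag S (mfreq S l r) (l + r)
      then diag S (mfreq S l r) (l + r) - 1 else l + r - (diag S (mfreq S l r) (l + r) - 1))"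
    have pos: "pos < length S" "is_mode (range_mset S l r) (S ! pos)"
      using diag_witness[OF lr(1) lr(2)[unfolded n_def] refl refl refl pos_def] by auto
    obtain t s' where t: "exec w D (map code S) mode_query (query_regs w (length S) l r) t s'"
      "t \<le> 100 * (1 + iter + Suc a)" "s' 0 = read_char (map code S) pos"
      using exec_mode_query[of "query_regs w (length S) l r"] by (auto simp: query_regs_def pos_def)
    have "real t \<le> real (100 * (2 + iter + a))" using t(2) unfolding of_nat_le_iff by simp
    moreover have "s' 0 = code (S ! pos)" using t(3) pos(1) by (simp add: read_char_def)
    ultimately show ?thesis unfolding reports_mode_def using t(1) pos(2) by blast
  qed
  moreover have "length (encode \<phi> fs) \<le> 2 ^ 12 * n * m"
    using fs_len(1) by (simp add: encode_def mult.commute)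
  ultimately show ?thesis by blast
qed

section \<open>Space and time bounds\<close>

lemma ex_power_bracket:
  assumes "0 < x"
  obtains e where "x \<le> 2 ^ e" "2 ^ e < 2 * (x :: nat)"
proof -
  define e where "e = (LEAST e. x \<le> 2 ^ e)"
  have e: "x \<le> 2 ^ e" unfolding e_def by (rule LeastI[of _ x]) (simp add: less_imp_le)
  have "2 ^ e < 2 * x"
  proof (cases e)
    case 0
    then show ?thesis using assms by simp
  next
    case (Suc e')
    have "\<not> x \<le> 2 ^ e'" using not_less_Least[of e' "\<lambda>e. x \<le> 2 ^ e"] Suc by (simp add: e_def)
    then show ?thesis by (simp add: Suc)
  qed
  with e that show thesis by blast
qed

lemma real_le_log2: "2 ^ k \<le> (x :: nat) \<Longrightarrow> real k \<le> log 2 (real x)"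
proof -
  assume "2 ^ k \<le> x"
  then have "real (2 ^ k) \<le> real x" by (rule of_nat_mono)
  then show ?thesis by (intro le_log_of_power) auto
qed

lemma exponent_le_log2:
  assumes "2 ^ E < 2 * (n :: nat)"
  shows "real E \<le> log 2 (real n) + 1"
proof -
  have n: "0 < n" using assms by (cases n) auto
  have "2 ^ E \<le> 2 * n" using assms by simp
  from real_le_log2[OF this] show ?thesis using n by (simp add: log_mult)
qed

text \<open>For \<open>L = log 2 n\<close>, the bounds \<open>E \<le> L + 1\<close> and
  \<open>1 \<le> L\<close> give \<open>4 * E + 80 \<le> 128 * L\<close>, hence
  \<open>\<kappa> \<le> 7 + log 2 L\<close>.\<close>

lemma kappa_le:
  assumes n: "2 \<le> n" "2 ^ E < 2 * n" and \<kappa>: "2 ^ \<kappa> < 2 * (2 * E + 40)"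
  shows "real \<kappa> \<le> 8 * max 1 (log 2 (log 2 (real n)))"
proof -
  let ?L = "log 2 (real n)"
  have L: "1 \<le> ?L" using n by simp
  have "real (2 * (2 * E + 40)) \<le> 128 * ?L" using exponent_le_log2[OF n(2)] L by simp
  then have "real (2 ^ \<kappa>) \<le> 128 * ?L" using \<kappa> by (meson less_imp_le of_nat_mono order_trans)
  then have "real \<kappa> \<le> log 2 (128 * ?L)" by (intro le_log_of_power) auto
  also have "\<dots> = log 2 (2 ^ 7) + log 2 ?L" using L by (subst log_mult) auto
  also have "log 2 (2 ^ 7 :: real) = 7" by (subst log_nat_power) auto
  finally show ?thesis by linarith
qed

text \<open>The left side \<open>8 * E + 160\<close> is at most \<open>8 * log 2 n + 168\<close>; as
  \<open>log 2 (n + 1)\<close> is at least 1, it is at most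
  \<open>176 * log 2 (n + 1)\<close>.\<close>

lemma word_length_bound:
  assumes "0 < n" "2 ^ E < 2 * n" "200 * log 2 (real n + 1) \<le> real w"
  shows "4 * (2 * E + 40) \<le> w"
proof -
  have "log 2 2 \<le> log 2 (real n + 1)" using assms by (intro log_mono) auto
  then have "1 \<le> log 2 (real n + 1)" by simp
  moreover have "log 2 (real n) \<le> log 2 (real n + 1)" using assms by (intro log_mono) auto
  moreover have "real (4 * (2 * E + 40)) = 8 * real E + 160" by simp
  ultimately have "real (4 * (2 * E + 40)) \<le> real w"
    using exponent_le_log2[OF assms(2)] assms(3) by linarith
  then show ?thesis by (simp only: of_nat_le_iff)
qed

lemma structure_exists:
  fixes S :: "'a list" and code :: "'a \<Rightarrow> nat"
  defines "n \<equiv> length S" and "m \<equiv> max_freq S"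
  assumes n: "0 < n" and w: "200 * log 2 (real n + 1) \<le> real w"
  shows "\<exists>D. length D \<le> 2 ^ 12 * n * m \<and> (\<forall>l r. l \<le> r \<longrightarrow> r < n \<longrightarrow>
    reports_mode w code mode_query D S l r (5000 * time_bound n m))"
proof -
  obtain E where E: "n \<le> 2 ^ E" "2 ^ E < 2 * n" using ex_power_bracket[OF n] .
  define b where "b = E div 2 + 1"
  define \<phi> where "\<phi> = 2 * E + 40"
  define q where "q = 2 * (2 * n div b + 1)"
  define base where "base = 12 + Suc m * q + 2 ^ b * b"
  obtain \<kappa> where \<kappa>: "\<phi> \<le> 2 ^ \<kappa>" "2 ^ \<kappa> < 2 * \<phi>"
    using ex_power_bracket[of \<phi>] by (auto simp: \<phi>_def)
  have w': "4 * \<phi> \<le> w" unfolding \<phi>_def using word_length_bound[OF n E(2) w] .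
  have mn: "m \<le> n" unfolding m_def n_def by (rule max_freq_le_length)
  have "0 < mfreq S 0 0" using n by (intro mfreq_pos) (auto simp: n_def)
  then have m0: "0 < m" using mfreq_le_max_freq[of S 0 0] by (simp add: m_def)
  note correct = structure_correct[OF n[unfolded n_def] E[unfolded n_def] b_def \<phi>_def
      q_def[unfolded n_def] w' base_def[unfolded m_def],
      folded n_def m_def]
  have mono: "reports_mode w code mode_query D S l r x \<Longrightarrow> x \<le> y \<Longrightarrow>
    reports_mode w code mode_query D S l r y" for D l r x y
    unfolding reports_mode_def by fastforce
  have tb: "1 \<le> time_bound n m" by (simp add: time_bound_def)
  show ?thesis
  \<comment> \<open>Here \<kappa> is O(log log n) for large \<open>n\<close>. If
    \<open>m < 2 ^ \<kappa>\<close>, plain binary search is fast enough; if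
    \<open>E < 2 * \<kappa> + 2\<close>, then \<open>n\<close> is so small that \<open>log m\<close>
    is O(\<kappa>).\<close>
  proof (cases "2 ^ \<kappa> \<le> m \<and> 2 * \<kappa> + 2 \<le> E")
    case True
    \<comment> \<open>The leaf side \<open>4 * 2 ^ \<kappa> * 2 ^ \<kappa>\<close> pays for the
      factors \<open>d0\<close> and \<open>\<phi>\<close> of the tree size, each at most
      \<open>2 ^ \<kappa>\<close>, and still leaves only O(\<kappa>) rounds of binary
      search.\<close>
    define a where "a = 2 * \<kappa> + 2"
    define d0 where "d0 = E - a"
    have aE: "a + d0 = E" using True unfolding a_def d0_def by linarith
    have "d0 < 2 ^ \<kappa>" using \<kappa>(1) by (simp add: d0_def \<phi>_def)
    moreover have "0 < base" by (simp add: base_def)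
    ultimately obtain xs p v where
      xs: "length xs \<le> d0 * (8 * m * 2 ^ d0)" "\<forall>x\<in>set xs. x \<le> m \<or> x \<le> base + length xs"
      and pv: "p \<le> base + length xs" "v \<le> m"
      and path: "\<forall>fs l r. (\<forall>i<length xs. base + i < length fs \<and> fs ! (base + i) = xs ! i) \<longrightarrow>
        l < 2 ^ (a + d0) \<longrightarrow> r < 2 ^ (a + d0) \<longrightarrow>
        search_path fs a (2 ^ a) l r (mfreq S l r) \<kappa> p v d0"
      using nodes_memory[of base d0 \<kappa> S a] unfolding m_def by blast
    have "length xs * \<phi> \<le> d0 * (8 * m * 2 ^ d0) * \<phi>" using xs(1) by simp
    also have "\<dots> \<le> 2 ^ \<kappa> * (8 * m * 2 ^ d0) * 2 ^ \<kappa>"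
      using \<kappa>(1) \<open>d0 < 2 ^ \<kappa>\<close> by (intro mult_le_mono) auto
    also have "\<dots> = 2 * m * 2 ^ E"
    proof -
      have "E = \<kappa> + \<kappa> + d0 + 2" using aE by (simp add: a_def)
      then show ?thesis by (simp add: power_add)
    qed
    also have "\<dots> \<le> 2 * m * (4 * n)" using E by (intro mult_le_mono) auto
    finally have size: "length xs * \<phi> \<le> 8 * n * m" by (simp add: ac_simps)
    have "\<exists>D. length D \<le> 2 ^ 12 * n * m \<and> (\<forall>l r. l \<le> r \<longrightarrow> r < n \<longrightarrow>
      reports_mode w code mode_query D S l r (real (100 * (2 + \<kappa> + a))))"
    proof (rule correct)
      show "length xs * \<phi> \<le> 8 * n * m" by (rule size)
      show "\<And>x. x \<in> set xs \<Longrightarrow> x \<le> m \<or> x \<le> base + length xs" using xs(2) by blast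
      show "p \<le> base + length xs" "v \<le> m" by (rule pv)+
      show "a < \<phi>" "d0 \<le> \<phi>" using aE by (simp_all add: \<phi>_def)
      show "search_path fs a (2 ^ a) l r (mfreq S l r) \<kappa> p v d0"
        if "\<And>i. i < length xs \<Longrightarrow> base + i < length fs \<and> fs ! (base + i) = xs ! i" "l < n" "r < n"
        for fs l r
        using path that E(1) unfolding aE by (meson less_le_trans)
    qed
    moreover have "real (100 * (2 + \<kappa> + a)) \<le> 5000 * time_bound n m"
    proof -
      have "real \<kappa> \<le> log 2 (real m)" using True by (intro real_le_log2) simp
      moreover have "2 ^ 1 \<le> (2 :: nat) ^ E" using True by (intro power_increasing) auto
      then have "2 < 2 * n" using E(2) by simp
      then have "2 \<le> n" by simp
      then have "real \<kappa> \<le> 8 * max 1 (log 2 (log 2 (real n)))"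
        using \<kappa>(2) E(2) unfolding \<phi>_def by (intro kappa_le) auto
      ultimately have "real \<kappa> \<le> 8 * time_bound n m" unfolding time_bound_def by linarith
      moreover have "real (100 * (2 + \<kappa> + a)) = 400 + 300 * real \<kappa>" by (simp add: a_def)
      ultimately show ?thesis using tb by linarith
    qed
    ultimately show ?thesis using mono by blast
  next
    case False
    \<comment> \<open>Bracketing \<open>m + 1\<close> gives
      \<open>2 ^ \<rho> \<le> m < 2 * 2 ^ \<rho>\<close> for \<open>\<rho> = e - 1\<close>, so a
      binary search from 0 with first step \<open>2 ^ \<rho>\<close> covers all frequencies up to
      \<open>m\<close>.\<close>
    obtain e where e: "m + 1 \<le> 2 ^ e" "2 ^ e < 2 * (m + 1)" using ex_power_bracket[of "m + 1"] by auto
    define \<rho> where "\<rho> = e - 1"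
    have "0 < e" using e(1) m0 by (cases e) auto
    then have "2 ^ e = 2 * (2 :: nat) ^ \<rho>" by (simp add: \<rho>_def flip: power_Suc)
    then have \<rho>: "2 ^ \<rho> \<le> m" "m < 2 * 2 ^ \<rho>" using e by simp_all
    then have "2 ^ \<rho> \<le> (2 :: nat) ^ E" using mn E(1) by linarith
    then have \<rho>E: "\<rho> \<le> E" by simp
    have "\<exists>D. length D \<le> 2 ^ 12 * n * m \<and> (\<forall>l r. l \<le> r \<longrightarrow> r < n \<longrightarrow>
      reports_mode w code mode_query D S l r (real (100 * (2 + 0 + \<rho>))))"
    proof (rule correct)
      show "length [] * \<phi> \<le> 8 * n * m" by simp
      show "search_path fs \<rho> (2 ^ \<rho>) l r (mfreq S l r) 0 0 0 0" for fs l r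
        using mfreq_le_max_freq[of S l r] \<rho>(2) by (simp add: m_def)
    qed (use \<rho>E in \<open>auto simp: \<phi>_def\<close>)
    moreover have "real (100 * (2 + 0 + \<rho>)) \<le> 5000 * time_bound n m"
    proof (cases "2 \<le> n")
      case True
      have "\<rho> \<le> 2 * \<kappa> + 2"
      proof (cases "2 ^ \<kappa> \<le> m")
        case True
        then show ?thesis using False \<rho>E by linarith
      next
        case False
        then have "2 ^ \<rho> < (2 :: nat) ^ \<kappa>" using \<rho>(1) by linarith
        then have "\<rho> < \<kappa>" by simp
        then show ?thesis by simp
      qed
      then have "real \<rho> \<le> 2 * real \<kappa> + 2" by linarith
      moreover have "real \<kappa> \<le> 8 * max 1 (log 2 (log 2 (real n)))"
        using \<kappa>(2) E(2) True unfolding \<phi>_def by (intro kappa_le) auto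
      moreover have "real \<rho> \<le> log 2 (real m)" using \<rho>(1) by (rule real_le_log2)
      \<comment> \<open>The factor is \<open>2 * 8 + 2\<close>, from
        \<open>\<rho> \<le> 2 * \<kappa> + 2\<close> and the bound on \<kappa>.\<close>
      ultimately have "real \<rho> \<le> 18 * time_bound n m" unfolding time_bound_def by linarith
      moreover have "real (100 * (2 + 0 + \<rho>)) = 200 + 100 * real \<rho>" by simp
      ultimately show ?thesis using tb by linarith
    next
      case False
      then have "2 ^ \<rho> < (2 :: nat) ^ 1" using \<rho>(1) mn by simp
      then have "\<rho> < 1" by (simp only: power_strict_increasing_iff one_less_numeral_iff semiring_norm)
      then show ?thesis using tb by simp
    qed
    ultimately show ?thesis using mono by blast
  qed
qed

theorem theorem12:
  "\<exists>(P :: prog) (c :: real) (C :: real).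
     \<forall>(A :: 'a set) (code :: 'a \<Rightarrow> nat) (S :: 'a list) (n :: nat) (m :: nat) (w :: nat).
       bij_betw code A {0..<card A} \<and> set S \<subseteq> A \<and> length S = n \<and> max_freq S = m \<and>
       card A \<le> 2 ^ w \<and> c * log 2 (real n + 1) \<le> real w \<longrightarrow>
       (\<exists>D :: bool list.
          real (length D) \<le> C * real n * real m \<and>
          (\<forall>l r. l \<le> r \<and> r < n \<longrightarrow> reports_mode w code P D S l r (C * time_bound n m)))"
proof (rule exI[of _ mode_query], rule exI[of _ 200], rule exI[of _ 5000], intro allI impI, elim conjE)
  fix A :: "'a set" and code :: "'a \<Rightarrow> nat" and S :: "'a list" and n m w :: nat
  assume S: "length S = n" "max_freq S = m" and w: "200 * log 2 (real n + 1) \<le> real w"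
  show "\<exists>D. real (length D) \<le> 5000 * real n * real m \<and>
    (\<forall>l r. l \<le> r \<and> r < n \<longrightarrow> reports_mode w code mode_query D S l r (5000 * time_bound n m))"
  proof (cases "n = 0")
    case True
    then show ?thesis by (intro exI[of _ "[]"]) simp
  next
    case False
    then obtain D where D: "length D \<le> 2 ^ 12 * n * m"
      "\<forall>l r. l \<le> r \<longrightarrow> r < n \<longrightarrow> reports_mode w code mode_query D S l r (5000 * time_bound n m)"
      using structure_exists[of S w code] S w by auto
    have "real (length D) \<le> real (2 ^ 12 * n * m)" using D(1) by (rule of_nat_mono)
    also have "\<dots> = 4096 * (real n * real m)" by simp
    also have "\<dots> \<le> 5000 * (real n * real m)" by (intro mult_right_mono) auto
    finally show ?thesis using D(2) by (auto simp: mult.assoc)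
  qed
qed

end
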